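(* Let $n<m$ be positive integers. The set of $n\times m$ rectangular unimodular matrices over $\mathbb{Z}$, viewed as a subset of $\mathbb{Z}^{nm}$, has a density, and this density is equal to $$\prod_{i=0}^{n-1}\frac{1}{\zeta(m-i)},$$ where $\zeta$ is the Riemann zeta function.
   Context: A matrix $M\in\mathrm{Mat}_{n\times m}(\mathbb{Z})$ with $n<m$ is rectangular unimodular if there exist $m-n$ rows in $\mathbb{Z}^m$ such that adjoining these rows to $M$ gives an $m\times m$ matrix whose determinant is a unit of $\mathbb{Z}$ (i.e. $\pm1$). The density of a set $S\subseteq\mathbb{Z}^d$ is $$\rho(S)=\lim_{B\to\infty}\frac{|S\cap[-B,B)^d|}{(2B)^d}$$ if the limit exists, with $B$ ranging over the positive integers. $\mathrm{Mat}_{n\times m}(\mathbb{Z})$ is identified entrywise with $\mathbb{Z}^{nm}$. *)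

theory Defs
  imports "Jordan_Normal_Form.Determinant"
begin

definition rect_unimodular :: "nat \<Rightarrow> nat \<Rightarrow> int mat set" where
  "rect_unimodular n m =
     {M \<in> carrier_mat n m. \<exists>R \<in> carrier_mat (m - n) m. is_unit (det (M @\<^sub>r R))}"

(* The identification of n x m matrices with vectors of length n * m is row by row. *)
definition vec_of_mat :: "'a mat \<Rightarrow> 'a vec" where
  "vec_of_mat M =
     vec (dim_row M * dim_col M) (\<lambda>k. M $$ (k div dim_col M, k mod dim_col M))"

definition int_cube :: "nat \<Rightarrow> nat \<Rightarrow> int vec set" where
  "int_cube d B = {v \<in> carrier_vec d. \<forall>i<d. - int B \<le> v $ i \<and> v $ i < int B}"

(* The limit exists and equals r. The value of the quotient at B = 0 does not affect it. *)
definition has_density :: "nat \<Rightarrow> int vec set \<Rightarrow> real \<Rightarrow> bool" where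
  "has_density d S r \<longleftrightarrow>
     (\<lambda>B. real (card (S \<inter> int_cube d B)) / (2 * real B) ^ d) \<longlonglongrightarrow> r"

(* The Riemann zeta function by its Dirichlet series, meaningful for real s > 1 only. *)
definition riemann_zeta :: "real \<Rightarrow> real" where
  "riemann_zeta s = (\<Sum>k. 1 / real (Suc k) powr s)"

end

theory Submission
  imports Defs "HOL-Number_Theory.Cong" "HOL-Library.FuncSet"
begin

text \<open>
  An integer \<open>n \<times> m\<close> matrix is rectangular unimodular iff its rows are independent modulo every
  prime. For the primes up to a bound \<open>P\<close> this is a periodic condition, and the Chinese remainder
  theorem and a count of full-rank matrices over the field with \<open>p\<close> elements give its density
  \<open>\<Prod>p\<le>P. \<Prod>i<n. 1 - p ^ (i - m)\<close>, which tends to the product of inverse zeta values by Euler's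
  product.

  It remains to see that few matrices in the box \<open>[-B, B)\<close> have dependent rows modulo some prime
  \<open>p > P\<close>. It suffices to look at the first \<open>n + 1\<close> columns, and by induction on \<open>k\<close> the leading
  \<open>k \<times> (k + 1)\<close> block may be assumed independent modulo all such primes when the
  \<open>(k + 1) \<times> (k + 2)\<close> block is considered. Then dependence modulo \<open>p\<close> confines both the next row and
  the next column to hyperplanes modulo \<open>p\<close>. For \<open>p \<le> 2B\<close> this is a set of relative size at most
  \<open>(2 / p)\<^sup>2\<close>, summable over \<open>p\<close>. A prime \<open>p > 2B\<close> must divide the leading minor of order \<open>k + 1\<close>; if
  that minor is nonzero it has boundedly many such prime divisors, each leaving at most one value
  for the last entry, and the minor vanishes with relative frequency \<open>O(1 / B)\<close>.
\<close>

section \<open>Row dependence modulo a prime\<close>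

text \<open>Matrices are functions on index pairs, so that \<open>k\<close> and \<open>l\<close>
  pick out a leading block of one fixed \<open>f\<close> and can vary freely in inductions. Integer
  coefficients with divisibility conditions stand for vectors over the field with \<open>p\<close>
  elements.\<close>

definition row_dependent :: "nat \<Rightarrow> nat \<Rightarrow> nat \<Rightarrow> (nat \<times> nat \<Rightarrow> int) \<Rightarrow> bool" where
  "row_dependent p k l f \<longleftrightarrow>
     (\<exists>u. (\<exists>i<k. \<not> int p dvd u i) \<and> (\<forall>j<l. int p dvd (\<Sum>i<k. u i * f (i, j))))"

lemma row_dependentI:
  "\<exists>i<k. \<not> int p dvd u i \<Longrightarrow> (\<And>j. j < l \<Longrightarrow> int p dvd (\<Sum>i<k. u i * f (i, j))) \<Longrightarrow> row_dependent p k l f"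
  unfolding row_dependent_def by (rule exI[of _ u]) simp

lemma row_dependentE:
  assumes "row_dependent p k l f"
  obtains u where "\<exists>i<k. \<not> int p dvd u i" "\<forall>j<l. int p dvd (\<Sum>i<k. u i * f (i, j))"
  using assms unfolding row_dependent_def by (rule exE) (erule conjE, rule that)

text \<open>Serves two purposes: reduction of the entries modulo \<open>p\<close>, and the remark
  that changing an entry outside the leading \<open>k\<close> by \<open>l\<close> block has no
  effect.\<close>

lemma row_dependent_cong:
  assumes "\<And>i j. i < k \<Longrightarrow> j < l \<Longrightarrow> [f (i, j) = g (i, j)] (mod int p)"
  shows "row_dependent p k l f \<longleftrightarrow> row_dependent p k l g"
proof -
  have "int p dvd (\<Sum>i<k. u i * f (i, j)) \<longleftrightarrow> int p dvd (\<Sum>i<k. u i * g (i, j))" if "j < l" for u j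
    by (intro cong_dvd_iff cong_sum cong_mult cong_refl) (use assms that in auto)
  then show ?thesis
    unfolding row_dependent_def by simp
qed

lemma row_dependent_mono_rows:
  assumes "row_dependent p k l f" "k \<le> k'"
  shows "row_dependent p k' l f"
proof -
  obtain u where u: "\<exists>i<k. \<not> int p dvd u i" "\<forall>j<l. int p dvd (\<Sum>i<k. u i * f (i, j))"
    using assms by (elim row_dependentE)
  define v where "v i = (if i < k then u i else 0)" for i
  have "(\<Sum>i<k'. v i * f (i, j)) = (\<Sum>i<k. u i * f (i, j))" for j
    by (rule sum.mono_neutral_cong_right) (use assms in \<open>auto simp: v_def\<close>)
  then have "\<forall>j<l. int p dvd (\<Sum>i<k'. v i * f (i, j))"
    using u(2) by presburger
  moreover obtain i where "i < k" "\<not> int p dvd u i"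
    using u(1) by blast
  then have "i < k'" "\<not> int p dvd v i"
    using assms(2) by (simp_all add: v_def)
  ultimately show ?thesis
    by (intro row_dependentI[of k' p v] exI[of _ i]) simp_all
qed

lemma row_dependent_mono_cols:
  "row_dependent p k l f \<Longrightarrow> l' \<le> l \<Longrightarrow> row_dependent p k l' f"
  by (erule row_dependentE, rule row_dependentI) auto

lemma not_row_dependent_0 [simp]: "\<not> row_dependent p 0 l f"
  by (simp add: row_dependent_def)

text \<open>The linear map sending a coefficient vector to the corresponding combination of rows
  modulo \<open>p\<close>. Representing its values by extensional functions into
  \<open>{0..<p}\<close> makes domain and codomain finite sets of known size, so that counting
  replaces dimension theory.\<close>

definition row_comb :: "nat \<Rightarrow> nat \<Rightarrow> nat \<Rightarrow> (nat \<times> nat \<Rightarrow> int) \<Rightarrow> (nat \<Rightarrow> int) \<Rightarrow> (nat \<Rightarrow> int)" where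
  "row_comb p k l f u = (\<lambda>j\<in>{..<l}. (\<Sum>i<k. u i * f (i, j)) mod int p)"

text \<open>The difference of two coefficient vectors with equal image is a dependence, and it is
  nontrivial because distinct reduced residues do not differ by a multiple of
  \<open>p\<close>.\<close>

lemma inj_on_row_comb:
  assumes "\<not> row_dependent p k l f"
  shows "inj_on (row_comb p k l f) (PiE {..<k} (\<lambda>_. {0..<int p}))"
proof (rule inj_onI)
  fix u v
  assume u: "u \<in> PiE {..<k} (\<lambda>_. {0..<int p})" and v: "v \<in> PiE {..<k} (\<lambda>_. {0..<int p})"
    and eq: "row_comb p k l f u = row_comb p k l f v"
  show "u = v"
  proof (rule PiE_ext[OF u v], rule ccontr)
    fix i assume i: "i \<in> {..<k}" and ne: "u i \<noteq> v i"
    have "0 \<le> u i" "u i < int p" "0 \<le> v i" "v i < int p"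
      using PiE_mem[OF u i] PiE_mem[OF v i] by simp_all
    then have "u i mod int p \<noteq> v i mod int p"
      using ne by simp
    then have "\<not> int p dvd u i - v i"
      by (simp add: mod_eq_dvd_iff)
    moreover have "int p dvd (\<Sum>i<k. (u i - v i) * f (i, j))" if "j < l" for j
    proof -
      have "(\<Sum>i<k. u i * f (i, j)) mod int p = (\<Sum>i<k. v i * f (i, j)) mod int p"
        using fun_cong[OF eq, of j] that by (simp add: row_comb_def)
      then have "int p dvd (\<Sum>i<k. u i * f (i, j)) - (\<Sum>i<k. v i * f (i, j))"
        by (simp only: mod_eq_dvd_iff)
      then show ?thesis by (simp only: left_diff_distrib sum_subtractf)
    qed
    ultimately have "row_dependent p k l f"
      using i by (intro row_dependentI[of k p "\<lambda>i. u i - v i"] exI[of _ i]) simp_all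
    with assms show False ..
  qed
qed

lemma row_comb_image:
  assumes "p > 0"
  shows "row_comb p k l f ` A \<subseteq> PiE {..<l} (\<lambda>_. {0..<int p})"
  using assms by (auto simp: row_comb_def split: if_splits)

text \<open>Pigeonhole principle: otherwise \<open>p ^ k\<close> coefficient vectors would inject
  into a set of \<open>p ^ l\<close> values.\<close>

lemma row_dependent_wide:
  assumes "l < k" "p \<ge> 2"
  shows "row_dependent p k l f"
proof (rule ccontr)
  assume nd: "\<not> row_dependent p k l f"
  have "card (PiE {..<k} (\<lambda>_. {0..<int p})) \<le> card (PiE {..<l} (\<lambda>_. {0..<int p}))"
  proof (rule card_inj_on_le[OF inj_on_row_comb[OF nd]])
    show "row_comb p k l f ` (PiE {..<k} (\<lambda>_. {0..<int p})) \<subseteq> PiE {..<l} (\<lambda>_. {0..<int p})"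
      by (rule row_comb_image) (use assms in simp)
  qed (simp add: finite_PiE)
  then have "p ^ k \<le> p ^ l"
    by (simp add: card_PiE)
  then have "k \<le> l"
    by (rule power_le_imp_le_exp[rotated]) (use assms in simp)
  with assms show False by simp
qed

text \<open>For a square block the map is an injection of a finite set into itself. This is what
  supplies inverse matrices modulo \<open>p\<close>.\<close>

lemma row_comb_surj:
  assumes "\<not> row_dependent p k k f" "p > 0" "t \<in> PiE {..<k} (\<lambda>_. {0..<int p})"
  obtains u where "row_comb p k k f u = t"
proof -
  let ?A = "PiE {..<k} (\<lambda>_. {0..<int p})"
  have "row_comb p k k f ` ?A = ?A"
  proof (rule endo_inj_surj)
    show "row_comb p k k f ` ?A \<subseteq> ?A"
      by (rule row_comb_image) (rule assms)
    show "inj_on (row_comb p k k f) ?A"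
      by (rule inj_on_row_comb) (rule assms)
  qed (simp add: finite_PiE)
  with assms(3) have "t \<in> row_comb p k k f ` ?A" by simp
  then show ?thesis
    by (elim imageE) (rule that, simp)
qed

section \<open>Determinants modulo a prime\<close>

lemma cong_det:
  assumes "A \<in> carrier_mat n n" "B \<in> carrier_mat n n"
    and "\<And>i j. i < n \<Longrightarrow> j < n \<Longrightarrow> [A $$ (i, j) = B $$ (i, j)] (mod q)"
  shows "[det A = det B] (mod (q :: int))"
proof -
  have "[(\<Prod>i = 0..<n. A $$ (i, \<pi> i)) = (\<Prod>i = 0..<n. B $$ (i, \<pi> i))] (mod q)"
    if "\<pi> permutes {0..<n}" for \<pi>
    by (intro cong_prod assms(3)) (use that permutes_in_image[OF that] in auto)
  then show ?thesis
    unfolding det_def'[OF assms(1)] det_def'[OF assms(2)]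
    by (intro cong_sum cong_mult cong_refl) auto
qed

text \<open>A dependence \<open>u\<close> multiplied by the matrix and then by its adjugate gives
  \<open>u i * det\<close>, so \<open>p\<close> divides the determinant. Conversely, independent
  rows yield an integer matrix that is a left inverse modulo \<open>p\<close>, and then the
  determinant is a unit modulo \<open>p\<close>.\<close>

lemma prime_dvd_det_iff:
  assumes p: "prime p"
  shows "int p dvd det (mat k k f) \<longleftrightarrow> row_dependent p k k f"
proof
  let ?X = "mat k k f"
  have X: "?X \<in> carrier_mat k k" by simp
  assume "row_dependent p k k f"
  then obtain u where u: "\<exists>i<k. \<not> int p dvd u i" "\<forall>j<k. int p dvd (\<Sum>i<k. u i * f (i, j))"
    by (elim row_dependentE)
  then obtain i where i: "i < k" "\<not> int p dvd u i" by blast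
  let ?a = "adj_mat ?X"
  have a: "?a \<in> carrier_mat k k" by (rule adj_mat[OF X])
  have entry: "(\<Sum>j<k. f (h, j) * ?a $$ (j, i)) = det ?X * (if h = i then 1 else 0)" if "h < k" for h
  proof -
    have "(?X * ?a) $$ (h, i) = (\<Sum>j<k. f (h, j) * ?a $$ (j, i))"
      using that i a by (auto simp: scalar_prod_def atLeast0LessThan intro!: sum.cong)
    then show ?thesis
      using adj_mat(2)[OF X] that i by simp
  qed
  \<comment> \<open>This is entry \<open>i\<close> of the row vector \<open>u\<close> times
    \<open>?X\<close> times its adjugate, associated in the two possible ways.\<close>
  have "(\<Sum>j<k. (\<Sum>h<k. u h * f (h, j)) * ?a $$ (j, i)) = (\<Sum>h<k. u h * (\<Sum>j<k. f (h, j) * ?a $$ (j, i)))"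
    unfolding sum_distrib_left sum_distrib_right by (subst sum.swap) (simp add: mult.assoc)
  also have "\<dots> = (\<Sum>h<k. if h = i then u i * det ?X else 0)"
    by (intro sum.cong) (auto simp: entry)
  also have "\<dots> = u i * det ?X"
    using i by (simp add: sum.delta')
  finally have "u i * det ?X = (\<Sum>j<k. (\<Sum>h<k. u h * f (h, j)) * ?a $$ (j, i))" ..
  moreover have "int p dvd \<dots>"
    by (intro dvd_sum) (use u in auto)
  ultimately have "int p dvd u i * det ?X" by simp
  then show "int p dvd det ?X"
    using i p by (simp add: prime_dvd_mult_iff)
next
  let ?X = "mat k k f"
  assume dvd: "int p dvd det ?X"
  have p0: "p > 1" using p prime_gt_1_nat by blast
  show "row_dependent p k k f"
  proof (rule ccontr)
    assume nd: "\<not> row_dependent p k k f"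
    \<comment> \<open>The preimages of the unit vectors are the rows of a left inverse of
      \<open>?X\<close> modulo \<open>p\<close>.\<close>
    let ?e = "\<lambda>h. \<lambda>j\<in>{..<k}. if j = h then 1 else 0 :: int"
    have "\<exists>u. row_comb p k k f u = ?e h" for h
      by (rule row_comb_surj[OF nd, of "?e h"]) (use p0 in auto)
    then obtain y where y: "\<And>h. row_comb p k k f (y h) = ?e h" by metis
    let ?Y = "mat k k (\<lambda>(h, i). y h i)"
    have "[det (?Y * ?X) = det (1\<^sub>m k)] (mod int p)"
    proof (rule cong_det)
      fix h j assume hj: "h < k" "j < k"
      have "(?Y * ?X) $$ (h, j) = (\<Sum>i<k. y h i * f (i, j))"
        using hj by (auto simp: scalar_prod_def atLeast0LessThan intro!: sum.cong)
      then show "[(?Y * ?X) $$ (h, j) = 1\<^sub>m k $$ (h, j)] (mod int p)"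
        using fun_cong[OF y, of h j] hj p0 by (auto simp: row_comb_def cong_def)
    qed auto
    then have "[det ?Y * det ?X = 1] (mod int p)"
      by (subst det_mult[symmetric]) auto
    then have "int p dvd 1"
      using dvd by (metis cong_dvd_iff dvd_mult)
    with p0 show False by simp
  qed
qed

text \<open>The \<open>k\<close> rows of length \<open>l > k\<close> have a common nonzero
  orthogonal vector \<open>w\<close> modulo \<open>p\<close>. If the next row creates a dependence,
  it lies in the span of the earlier rows and is orthogonal to \<open>w\<close> too. The
  quantification over \<open>g\<close> records that \<open>w\<close> depends on the first
  \<open>k\<close> rows only, so that the next row may vary in a count.\<close>

lemma row_hyperplane:
  assumes p: "prime p" and "k < l" and nd: "\<not> row_dependent p k l f"
  obtains w where "\<exists>j<l. \<not> int p dvd w j"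
    and "\<forall>g. (\<forall>i<k. \<forall>j<l. g (i, j) = f (i, j)) \<longrightarrow> row_dependent p (Suc k) l g \<longrightarrow>
              int p dvd (\<Sum>j<l. g (k, j) * w j)"
proof -
  \<comment> \<open>The transposed block has more rows than columns; a dependence of its rows is the
    wanted \<open>w\<close>.\<close>
  obtain w where w: "\<exists>j<l. \<not> int p dvd w j" "\<forall>i<k. int p dvd (\<Sum>j<l. w j * f (i, j))"
    using row_dependent_wide[OF \<open>k < l\<close>, of p "\<lambda>(j, i). f (i, j)"] prime_ge_2_nat[OF p]
    unfolding row_dependent_def by auto
  show thesis
  proof (rule that[OF w(1)], intro allI impI)
    fix g :: "nat \<times> nat \<Rightarrow> int"
    assume g: "\<forall>i<k. \<forall>j<l. g (i, j) = f (i, j)" and d: "row_dependent p (Suc k) l g"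
    obtain u where u: "\<exists>i<Suc k. \<not> int p dvd u i" "\<forall>j<l. int p dvd (\<Sum>i<Suc k. u i * g (i, j))"
      using d by (elim row_dependentE)
    have ndg: "\<not> row_dependent p k l g"
      using nd row_dependent_cong[of k l g f p] g by auto
    have uk: "\<not> int p dvd u k"
    proof
      assume uk: "int p dvd u k"
      then have "\<exists>i<k. \<not> int p dvd u i" using u(1) less_Suc_eq by auto
      moreover have "int p dvd (\<Sum>i<k. u i * g (i, j))" if "j < l" for j
        using u(2) that uk by (auto simp: dvd_add_left_iff)
      ultimately show False using ndg row_dependentI[of k p u l g] by simp
    qed
    \<comment> \<open>Pairing the dependence with \<open>w\<close> kills the first \<open>k\<close>
      rows modulo \<open>p\<close> and leaves \<open>u k\<close> times the pairing of row
      \<open>k\<close> with \<open>w\<close>.\<close>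
    have "(\<Sum>j<l. w j * (\<Sum>i<Suc k. u i * g (i, j)))
        = (\<Sum>j<l. w j * (\<Sum>i<k. u i * f (i, j))) + u k * (\<Sum>j<l. g (k, j) * w j)"
      by (simp add: distrib_left sum.distrib sum_distrib_left g algebra_simps)
    also have "(\<Sum>j<l. w j * (\<Sum>i<k. u i * f (i, j))) = (\<Sum>i<k. u i * (\<Sum>j<l. w j * f (i, j)))"
      unfolding sum_distrib_left by (subst sum.swap) (simp add: mult.left_commute)
    finally have eq: "(\<Sum>j<l. w j * (\<Sum>i<Suc k. u i * g (i, j)))
        = (\<Sum>i<k. u i * (\<Sum>j<l. w j * f (i, j))) + u k * (\<Sum>j<l. g (k, j) * w j)" .
    have "int p dvd (\<Sum>j<l. w j * (\<Sum>i<Suc k. u i * g (i, j)))"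
      by (rule dvd_sum, rule dvd_mult) (use u in auto)
    moreover have "int p dvd (\<Sum>i<k. u i * (\<Sum>j<l. w j * f (i, j)))"
      by (rule dvd_sum, rule dvd_mult) (use w in auto)
    ultimately have "int p dvd u k * (\<Sum>j<l. g (k, j) * w j)"
      unfolding eq by (simp add: dvd_add_right_iff)
    then show "int p dvd (\<Sum>j<l. g (k, j) * w j)"
      using uk p by (simp add: prime_dvd_mult_iff)
  qed
qed

text \<open>As the first \<open>k\<close> rows are independent, the dependence \<open>u\<close> of
  the \<open>k + 1\<close> rows on the first \<open>l\<close> columns is unique modulo
  \<open>p\<close> up to a scalar. A dependence on \<open>l + 1\<close> columns restricts to one on
  \<open>l\<close> columns, hence is proportional to \<open>u\<close>, and so \<open>u\<close> also
  annihilates the new column. Since \<open>u k\<close> is invertible modulo \<open>p\<close>, the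
  entry \<open>(k, l)\<close> is then determined by the rest of its column.\<close>

lemma column_hyperplane:
  assumes p: "prime p" and nd: "\<not> row_dependent p k l f" and d: "row_dependent p (Suc k) l f"
  obtains u where "\<not> int p dvd u k"
    and "\<forall>g. (\<forall>i<Suc k. \<forall>j<l. g (i, j) = f (i, j)) \<longrightarrow>
              row_dependent p (Suc k) (Suc l) g \<longrightarrow> int p dvd (\<Sum>i<Suc k. u i * g (i, l))"
proof -
  have last: "\<not> int p dvd v k"
    if "\<exists>i<Suc k. \<not> int p dvd v i" "\<forall>j<l. int p dvd (\<Sum>i<Suc k. v i * f (i, j))" for v
  proof
    assume vk: "int p dvd v k"
    then have "\<exists>i<k. \<not> int p dvd v i" using that(1) less_Suc_eq by auto
    moreover have "int p dvd (\<Sum>i<k. v i * f (i, j))" if "j < l" for j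
      using \<open>\<forall>j<l. _ dvd _\<close> that vk by (auto simp: dvd_add_left_iff)
    ultimately show False using nd row_dependentI[of k p v l f] by simp
  qed
  obtain u where u: "\<exists>i<Suc k. \<not> int p dvd u i" "\<forall>j<l. int p dvd (\<Sum>i<Suc k. u i * f (i, j))"
    using d by (elim row_dependentE)
  have uk: "\<not> int p dvd u k" using last[OF u] .
  show thesis
  proof (rule that[of u, OF uk], intro allI impI)
    fix g :: "nat \<times> nat \<Rightarrow> int"
    assume g: "\<forall>i<Suc k. \<forall>j<l. g (i, j) = f (i, j)"
      and dg: "row_dependent p (Suc k) (Suc l) g"
    obtain v where v: "\<exists>i<Suc k. \<not> int p dvd v i" "\<forall>j<Suc l. int p dvd (\<Sum>i<Suc k. v i * g (i, j))"
      using dg by (elim row_dependentE)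
    have vf: "\<forall>j<l. int p dvd (\<Sum>i<Suc k. v i * f (i, j))"
    proof (intro allI impI)
      fix j assume j: "j < l"
      have "(\<Sum>i<Suc k. v i * f (i, j)) = (\<Sum>i<Suc k. v i * g (i, j))"
        by (rule sum.cong) (use g j in auto)
      then show "int p dvd (\<Sum>i<Suc k. v i * f (i, j))" using v(2) j by simp
    qed
    \<comment> \<open>A combination of \<open>u\<close> and \<open>v\<close> whose last coefficient
      cancels. By \<open>last\<close> it must vanish modulo \<open>p\<close>, which is the
      proportionality of \<open>u\<close> and \<open>v\<close>.\<close>
    define x where "x i = v k * u i - u k * v i" for i
    have "\<forall>j<l. int p dvd (\<Sum>i<Suc k. x i * f (i, j))"
    proof (intro allI impI)
      fix j assume j: "j < l"
      have "(\<Sum>i<Suc k. x i * f (i, j))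
            = v k * (\<Sum>i<Suc k. u i * f (i, j)) - u k * (\<Sum>i<Suc k. v i * f (i, j))"
        unfolding x_def sum_distrib_left by (simp only: left_diff_distrib sum_subtractf mult.assoc)
      then show "int p dvd (\<Sum>i<Suc k. x i * f (i, j))"
        using u(2) vf j by (simp only: dvd_diff dvd_mult)
    qed
    then have "(\<exists>i<Suc k. \<not> int p dvd x i) \<Longrightarrow> \<not> int p dvd x k"
      by (rule last[rotated])
    moreover have "int p dvd x k" by (simp add: x_def mult.commute)
    ultimately have "\<not> (\<exists>i<Suc k. \<not> int p dvd x i)" by blast
    then have "int p dvd (\<Sum>i<Suc k. x i * g (i, l))"
      by (intro dvd_sum dvd_mult2) simp
    moreover have "v k * (\<Sum>i<Suc k. u i * g (i, l))
            = (\<Sum>i<Suc k. x i * g (i, l)) + u k * (\<Sum>i<Suc k. v i * g (i, l))"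
      unfolding x_def sum_distrib_left
      by (simp only: left_diff_distrib sum_subtractf mult.assoc diff_add_cancel)
    moreover have "int p dvd u k * (\<Sum>i<Suc k. v i * g (i, l))"
      using v(2) by (intro dvd_mult) simp
    ultimately have "int p dvd v k * (\<Sum>i<Suc k. u i * g (i, l))"
      by (simp only: dvd_add)
    moreover have "prime (int p)" using p by simp
    ultimately show "int p dvd (\<Sum>i<Suc k. u i * g (i, l))"
      using last[OF v(1) vf] by (simp only: prime_dvd_mult_iff simp_thms)
  qed
qed

section \<open>Unimodular completion\<close>

text \<open>Rows are added one at a time; each can be a unit vector, because some unit vector lies
  outside the hyperplane given by \<open>row_hyperplane\<close>.\<close>

lemma extend_not_row_dependent:
  assumes p: "prime p" and "n \<le> k" "k \<le> m" and nd: "\<not> row_dependent p n m f"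
  shows "\<exists>g. (\<forall>i<n. \<forall>j<m. g (i, j) = f (i, j)) \<and> \<not> row_dependent p k m g"
  using \<open>n \<le> k\<close> \<open>k \<le> m\<close>
proof (induction k rule: dec_induct)
  case base
  with nd show ?case by (intro exI[of _ f]) simp
next
  case (step k)
  then obtain g where g: "\<forall>i<n. \<forall>j<m. g (i, j) = f (i, j)" "\<not> row_dependent p k m g"
    by auto
  have km: "k < m" using step.prems by simp
  obtain w where w: "\<exists>j<m. \<not> int p dvd w j"
    "\<forall>h. (\<forall>i<k. \<forall>j<m. h (i, j) = g (i, j)) \<longrightarrow> row_dependent p (Suc k) m h \<longrightarrow>
              int p dvd (\<Sum>j<m. h (k, j) * w j)"
    by (rule row_hyperplane[OF p km g(2)])
  obtain j0 where j0: "j0 < m" "\<not> int p dvd w j0" using w(1) by blast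
  \<comment> \<open>The new row is the unit vector at \<open>j0\<close>, whose pairing with
    \<open>w\<close> is \<open>w j0\<close>.\<close>
  define h where "h = (\<lambda>(i, j). if i = k then (if j = j0 then 1 else 0) else g (i, j))"
  have "(\<Sum>j<m. h (k, j) * w j) = (\<Sum>j<m. if j = j0 then w j else 0)"
    by (rule sum.cong) (auto simp: h_def)
  also have "\<dots> = w j0" using j0 by (simp add: sum.delta)
  finally have "\<not> row_dependent p (Suc k) m h"
    using w(2)[rule_format, of h] j0 by (auto simp: h_def)
  moreover have "\<forall>i<n. \<forall>j<m. h (i, j) = f (i, j)"
    using g(1) step.hyps by (auto simp: h_def)
  ultimately show ?case by blast
qed

lemma mat_mult_adj_entry:
  fixes g :: "nat \<times> nat \<Rightarrow> 'a :: comm_ring_1"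
  assumes "h < m" "i < m"
  shows "(\<Sum>j<m. g (h, j) * cofactor (mat m m g) i j) = (if h = i then det (mat m m g) else 0)"
proof -
  let ?X = "mat m m g"
  have X: "?X \<in> carrier_mat m m" by simp
  have "(?X * adj_mat ?X) $$ (h, i) = (\<Sum>j<m. g (h, j) * cofactor ?X i j)"
    using assms by (simp add: scalar_prod_def adj_mat_def atLeast0LessThan)
  then show ?thesis
    using adj_mat(2)[OF X] assms by (cases "h = i") simp_all
qed

text \<open>In the Laplace expansion along row \<open>k\<close> the cofactors do not depend on that
  row, and they are orthogonal to all other rows, so only the coefficient \<open>v k\<close>
  survives. Keeping the factor \<open>q\<close> on the left avoids division in the ring.\<close>

lemma det_replace_row:
  fixes g :: "nat \<times> nat \<Rightarrow> 'a :: comm_ring_1"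
  assumes "k < m" and c: "\<And>j. j < m \<Longrightarrow> q * c j = (\<Sum>i<m. v i * g (i, j))"
  shows "q * det (mat m m (\<lambda>(i, j). if i = k then c j else g (i, j))) = v k * det (mat m m g)"
proof -
  let ?X = "mat m m g"
  let ?Y = "mat m m (\<lambda>(i, j). if i = k then c j else g (i, j))"
  have del: "mat_delete ?Y k j = mat_delete ?X k j" for j
    unfolding mat_delete_def by (rule cong_mat) auto
  have "det ?Y = (\<Sum>j<m. ?Y $$ (k, j) * cofactor ?Y k j)"
    by (rule laplace_expansion_row) (use assms in auto)
  also have "\<dots> = (\<Sum>j<m. c j * cofactor ?X k j)"
    by (rule sum.cong) (use assms(1) in \<open>auto simp: cofactor_def del\<close>)
  finally have "q * det ?Y = (\<Sum>j<m. (q * c j) * cofactor ?X k j)"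
    by (simp add: sum_distrib_left mult.assoc)
  also have "\<dots> = (\<Sum>j<m. (\<Sum>i<m. v i * g (i, j)) * cofactor ?X k j)"
    using c by simp
  also have "\<dots> = (\<Sum>i<m. v i * (\<Sum>j<m. g (i, j) * cofactor ?X k j))"
    unfolding sum_distrib_left sum_distrib_right by (subst sum.swap) (simp add: mult.assoc)
  also have "\<dots> = (\<Sum>i<m. if i = k then v i * det ?X else 0)"
    by (rule sum.cong) (use assms(1) in \<open>auto simp: mat_mult_adj_entry\<close>)
  also have "\<dots> = v k * det ?X"
    using assms(1) by (simp add: sum.delta)
  finally show ?thesis .
qed

text \<open>A completion with minimal nonzero \<open>\<bar>det\<bar>\<close> is unimodular: if a prime \<open>p\<close> divides the determinant,
  some combination of the rows with coefficients in \<open>[0, p)\<close> is divisible by \<open>p\<close>, and its quotient by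
  \<open>p\<close> can replace an added row, which makes the determinant smaller.\<close>

lemma unimodular_extension_iff:
  assumes "n \<le> m"
  shows "(\<exists>g. (\<forall>i<n. \<forall>j<m. g (i, j) = f (i, j)) \<and> is_unit (det (mat m m g :: int mat)))
    \<longleftrightarrow> (\<forall>p. prime p \<longrightarrow> \<not> row_dependent p n m f)"
proof (intro iffI allI impI notI)
  fix p assume p: "prime p" and d: "row_dependent p n m f"
    and "\<exists>g. (\<forall>i<n. \<forall>j<m. g (i, j) = f (i, j)) \<and> is_unit (det (mat m m g :: int mat))"
  then obtain g where g: "\<forall>i<n. \<forall>j<m. g (i, j) = f (i, j)" "is_unit (det (mat m m g :: int mat))"
    by blast
  have "row_dependent p n m g"
    using d row_dependent_cong[of n m f g p] g(1) by simp
  then have "int p dvd det (mat m m g)"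
    using prime_dvd_det_iff[OF p] row_dependent_mono_rows assms by blast
  then have "is_unit (int p)"
    using g(2) dvd_trans by blast
  with p show False by simp
next
  assume nd: "\<forall>p. prime p \<longrightarrow> \<not> row_dependent p n m f"
  define P where "P g \<longleftrightarrow> (\<forall>i<n. \<forall>j<m. g (i, j) = f (i, j)) \<and> det (mat m m g) \<noteq> 0" for g
  \<comment> \<open>Any prime would do here: independence modulo 2 merely guarantees some completion
    with nonzero determinant, from which a minimal one is chosen.\<close>
  have "prime (2 :: nat)" by simp
  then obtain g0 where "\<forall>i<n. \<forall>j<m. g0 (i, j) = f (i, j)" "\<not> row_dependent 2 m m g0"
    using extend_not_row_dependent[of 2 n m m f] nd assms by blast
  moreover from this have "det (mat m m g0) \<noteq> 0"
    using prime_dvd_det_iff[of 2 m g0] by auto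
  ultimately have "P g0" by (simp add: P_def)
  then obtain g where g: "P g" and min: "\<And>h. P h \<Longrightarrow> nat \<bar>det (mat m m g)\<bar> \<le> nat \<bar>det (mat m m h)\<bar>"
    using ex_has_least_nat[of P g0 "\<lambda>g. nat \<bar>det (mat m m g)\<bar>"] by blast
  have "is_unit (det (mat m m g))"
  proof (rule ccontr)
    let ?d = "det (mat m m g)"
    assume "\<not> is_unit ?d"
    then have "nat \<bar>?d\<bar> \<noteq> 1" by (simp add: nat_eq_iff)
    then obtain p where p: "prime p" "p dvd nat \<bar>?d\<bar>"
      using prime_factor_nat by blast
    then have "int p dvd ?d" by (simp add: int_dvd_int_iff[symmetric])
    then have "row_dependent p m m g"
      using prime_dvd_det_iff[OF p(1)] by blast
    then obtain u where u: "\<exists>i<m. \<not> int p dvd u i" "\<forall>j<m. int p dvd (\<Sum>i<m. u i * g (i, j))"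
      by (elim row_dependentE)
    \<comment> \<open>Only added rows may be replaced. If all their coefficients were divisible by
      \<open>p\<close>, the dependence would already be one of the given rows.\<close>
    have "\<exists>k. n \<le> k \<and> k < m \<and> \<not> int p dvd u k"
    proof (rule ccontr)
      assume *: "\<not> (\<exists>k. n \<le> k \<and> k < m \<and> \<not> int p dvd u k)"
      have "row_dependent p n m g"
      proof (rule row_dependentI)
        show "\<exists>i<n. \<not> int p dvd u i" using u(1) * by (metis not_le_imp_less)
        fix j assume j: "j < m"
        have "{..<m} = {..<n} \<union> {n..<m}" using assms by auto
        moreover have "{..<n} \<inter> {n..<m} = {}" by auto
        ultimately have "(\<Sum>i<m. u i * g (i, j)) = (\<Sum>i<n. u i * g (i, j)) + (\<Sum>i=n..<m. u i * g (i, j))"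
          by (simp add: sum.union_disjoint)
        moreover have "int p dvd (\<Sum>i=n..<m. u i * g (i, j))"
          by (rule dvd_sum, rule dvd_mult2) (use * in auto)
        moreover have "int p dvd (\<Sum>i<m. u i * g (i, j))"
          using u(2) j by simp
        ultimately show "int p dvd (\<Sum>i<n. u i * g (i, j))"
          by (simp only: dvd_add_left_iff)
      qed
      then have "row_dependent p n m f"
        using row_dependent_cong[of n m f g p] g by (simp add: P_def)
      with nd p(1) show False by blast
    qed
    then obtain k where k: "n \<le> k" "k < m" "\<not> int p dvd u k" by blast
    \<comment> \<open>Reduced coefficients satisfy \<open>0 < v k < p\<close>, so replacing row
      \<open>k\<close> multiplies the determinant by \<open>v k / p\<close>, a number strictly
      between 0 and 1.\<close>
    define v where "v i = u i mod int p" for i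
    have "0 < int p" using p(1) prime_gt_0_nat[of p] by simp
    then have "0 \<le> v k" "v k < int p"
      unfolding v_def by (rule pos_mod_sign, rule pos_mod_bound)
    moreover have "v k \<noteq> 0"
      using k(3) unfolding v_def dvd_eq_mod_eq_0 .
    ultimately have vk: "0 < v k" "v k < int p"
      by linarith+
    have dvd: "int p dvd (\<Sum>i<m. v i * g (i, j))" if "j < m" for j
    proof -
      have "[(\<Sum>i<m. v i * g (i, j)) = (\<Sum>i<m. u i * g (i, j))] (mod int p)"
        by (intro cong_sum cong_mult cong_refl) (simp add: v_def)
      then show ?thesis using u(2) that by (simp add: cong_dvd_iff)
    qed
    define c where "c j = (\<Sum>i<m. v i * g (i, j)) div int p" for j
    have c: "int p * c j = (\<Sum>i<m. v i * g (i, j))" if "j < m" for j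
      unfolding c_def by (rule dvd_mult_div_cancel) (rule dvd[OF that])
    define h where "h = (\<lambda>(i, j). if i = k then c j else g (i, j))"
    have det: "int p * det (mat m m h) = v k * ?d"
      unfolding h_def by (rule det_replace_row[OF k(2) c])
    have "?d \<noteq> 0" using g by (simp add: P_def)
    then have "v k * ?d \<noteq> 0" using vk by simp
    then have "det (mat m m h) \<noteq> 0" using det by (metis mult_zero_right)
    moreover have "\<forall>i<n. \<forall>j<m. h (i, j) = f (i, j)"
      using g k(1) by (auto simp: P_def h_def)
    ultimately have "P h" by (simp add: P_def)
    then have le: "\<bar>?d\<bar> \<le> \<bar>det (mat m m h)\<bar>"
      using min by fastforce
    have "int p * \<bar>det (mat m m h)\<bar> = v k * \<bar>?d\<bar>"
      using arg_cong[OF det, of abs] vk by (simp add: abs_mult)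
    also have "\<dots> < int p * \<bar>?d\<bar>"
      using vk \<open>?d \<noteq> 0\<close> by (intro mult_strict_right_mono) auto
    finally show False using le by (simp add: mult_less_cancel_left split: if_splits)
  qed
  with g show "\<exists>g. (\<forall>i<n. \<forall>j<m. g (i, j) = f (i, j)) \<and> is_unit (det (mat m m g :: int mat))"
    by (auto simp: P_def)
qed

lemma rect_unimodular_iff:
  assumes "n \<le> m" and M: "M \<in> carrier_mat n m"
  shows "M \<in> rect_unimodular n m \<longleftrightarrow> (\<forall>p. prime p \<longrightarrow> \<not> row_dependent p n m (\<lambda>ij. M $$ ij))"
proof -
  have app: "(M @\<^sub>r R) = mat m m (\<lambda>(i, j). if i < n then M $$ (i, j) else R $$ (i - n, j))"
    if "R \<in> carrier_mat (m - n) m" for R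
    by (rule eq_matI) (use assms that in \<open>auto simp: append_rows_def\<close>)
  have "M \<in> rect_unimodular n m \<longleftrightarrow>
      (\<exists>g. (\<forall>i<n. \<forall>j<m. g (i, j) = M $$ (i, j)) \<and> is_unit (det (mat m m g :: int mat)))" (is "?l \<longleftrightarrow> ?r")
  proof
    assume ?l
    then obtain R where R: "R \<in> carrier_mat (m - n) m" "is_unit (det (M @\<^sub>r R))"
      unfolding rect_unimodular_def by blast
    then show ?r
      by (intro exI[of _ "\<lambda>(i, j). if i < n then M $$ (i, j) else R $$ (i - n, j)"])
        (simp add: app[OF R(1)])
  next
    assume ?r
    then obtain g where g: "\<forall>i<n. \<forall>j<m. g (i, j) = M $$ (i, j)" "is_unit (det (mat m m g :: int mat))"
      by blast
    define R where "R = mat (m - n) m (\<lambda>(i, j). g (i + n, j))"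
    have R: "R \<in> carrier_mat (m - n) m" by (simp add: R_def)
    have "M @\<^sub>r R = mat m m g"
      unfolding app[OF R] by (rule cong_mat) (use g(1) assms in \<open>auto simp: R_def\<close>)
    then show ?l
      using g(2) R M unfolding rect_unimodular_def by (intro CollectI conjI bexI[of _ R]) simp_all
  qed
  then show ?thesis
    using unimodular_extension_iff[OF assms(1), of "\<lambda>ij. M $$ ij"] by simp
qed

section \<open>Counting in boxes and residue systems\<close>

text \<open>Double counting along a lens: the pairs \<open>(x, s)\<close> with \<open>x \<in> X\<close> correspond to the pairs
  \<open>(y, s)\<close> with \<open>upd y s \<in> X\<close> via \<open>(x, s) \<mapsto> (upd x s, get x)\<close>.\<close>

lemma card_fibers:
  assumes fin: "finite Y" "finite S" and XY: "X \<subseteq> Y"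
    and get: "\<And>y. y \<in> Y \<Longrightarrow> get y \<in> S"
    and upd: "\<And>y s. y \<in> Y \<Longrightarrow> s \<in> S \<Longrightarrow> upd y s \<in> Y"
    and upd_get: "\<And>y. y \<in> Y \<Longrightarrow> upd y (get y) = y"
    and get_upd: "\<And>y s. y \<in> Y \<Longrightarrow> s \<in> S \<Longrightarrow> get (upd y s) = s"
    and upd_upd: "\<And>y s t. y \<in> Y \<Longrightarrow> s \<in> S \<Longrightarrow> t \<in> S \<Longrightarrow> upd (upd y s) t = upd y t"
  shows "card X * card S = (\<Sum>y\<in>Y. card {s \<in> S. upd y s \<in> X})"
proof -
  have "bij_betw (\<lambda>(x, s). (upd x s, get x)) (X \<times> S) (SIGMA y:Y. {s \<in> S. upd y s \<in> X})"
  proof (rule bij_betw_byWitness[where f' = "\<lambda>(y, s). (upd y s, get y)"])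
    show "\<forall>a\<in>X \<times> S. (\<lambda>(y, s). (upd y s, get y)) ((\<lambda>(x, s). (upd x s, get x)) a) = a"
    proof (clarsimp, intro conjI)
      fix x s assume "x \<in> X" "s \<in> S"
      with XY have "x \<in> Y" by auto
      with \<open>s \<in> S\<close> show "upd (upd x s) (get x) = x" "get (upd x s) = s"
        by (simp_all add: upd_upd get upd_get get_upd)
    qed
    show "\<forall>a\<in>SIGMA y:Y. {s \<in> S. upd y s \<in> X}.
        (\<lambda>(x, s). (upd x s, get x)) ((\<lambda>(y, s). (upd y s, get y)) a) = a"
      by (auto simp: upd_upd get upd_get get_upd)
    show "(\<lambda>(x, s). (upd x s, get x)) ` (X \<times> S) \<subseteq> (SIGMA y:Y. {s \<in> S. upd y s \<in> X})"
    proof clarsimp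
      fix x s assume "x \<in> X" "s \<in> S"
      with XY have "x \<in> Y" by auto
      with \<open>x \<in> X\<close> \<open>s \<in> S\<close> show "upd x s \<in> Y \<and> get x \<in> S \<and> upd (upd x s) (get x) \<in> X"
        by (simp add: upd_upd get upd_get get_upd upd)
    qed
    show "(\<lambda>(y, s). (upd y s, get y)) ` (SIGMA y:Y. {s \<in> S. upd y s \<in> X}) \<subseteq> X \<times> S"
      using get by auto
  qed
  then have "card (X \<times> S) = card (SIGMA y:Y. {s \<in> S. upd y s \<in> X})"
    by (rule bij_betw_same_card)
  then show ?thesis
    using fin by (simp add: card_cartesian_product)
qed

text \<open>In the applications \<open>upd\<close> overwrites one entry of a matrix and
  \<open>get\<close> reads it; the conclusion then bounds the relative size of \<open>X\<close> in
  \<open>Y\<close> by \<open>K / card S\<close>.\<close>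

lemma card_fibers_le:
  assumes "finite Y" "finite S" "X \<subseteq> Y"
    and "\<And>y. y \<in> Y \<Longrightarrow> get y \<in> S"
    and "\<And>y s. y \<in> Y \<Longrightarrow> s \<in> S \<Longrightarrow> upd y s \<in> Y"
    and "\<And>y. y \<in> Y \<Longrightarrow> upd y (get y) = y"
    and "\<And>y s. y \<in> Y \<Longrightarrow> s \<in> S \<Longrightarrow> get (upd y s) = s"
    and "\<And>y s t. y \<in> Y \<Longrightarrow> s \<in> S \<Longrightarrow> t \<in> S \<Longrightarrow> upd (upd y s) t = upd y t"
    and K: "\<And>y. y \<in> Y \<Longrightarrow> real (card {s \<in> S. upd y s \<in> X}) \<le> K"
  shows "real (card X) * real (card S) \<le> K * real (card Y)"
proof -
  have "real (card X) * real (card S) = (\<Sum>y\<in>Y. real (card {s \<in> S. upd y s \<in> X}))"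
    using card_fibers[of Y S X get upd] assms by (simp flip: of_nat_mult)
  also have "\<dots> \<le> (\<Sum>y\<in>Y. K)"
    by (rule sum_mono) (rule K)
  finally show ?thesis by (simp add: mult.commute)
qed

section \<open>Residue classes in an interval\<close>

lemma finite_range_Collect: "finite {x \<in> {a..<b :: int}. P x}"
  by (rule finite_subset[of _ "{a..<b}"]) auto

text \<open>Writing \<open>x = c + q * t\<close>, the parameter \<open>t\<close> runs through the
  integers of a half-open real interval of length \<open>2 * B / q\<close>. Their number is a
  difference of two ceilings, each of which exceeds its argument by less than 1.\<close>

lemma card_residue_class:
  assumes "q > 0"
  shows "\<bar>real (card {x \<in> {- int B..<int B}. [x = c] (mod int q)}) - 2 * real B / real q\<bar> < 1"
proof -
  let ?lo = "\<lceil>(- real B - real_of_int c) / real q\<rceil>" and ?hi = "\<lceil>(real B - real_of_int c) / real q\<rceil>"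
  have mem: "c + int q * t \<in> {- int B..<int B} \<longleftrightarrow> t \<in> {?lo..<?hi}" for t
  proof -
    have "- int B \<le> c + int q * t \<longleftrightarrow> - real B - real_of_int c \<le> real_of_int t * real q"
      by (simp add: of_int_le_iff[where 'a = real, symmetric] algebra_simps del: of_int_le_iff)
    moreover have "c + int q * t < int B \<longleftrightarrow> real_of_int t * real q < real B - real_of_int c"
      by (simp add: of_int_less_iff[where 'a = real, symmetric] algebra_simps del: of_int_less_iff)
    ultimately show ?thesis
      using assms by (simp add: ceiling_le_iff less_ceiling_iff pos_divide_le_eq pos_less_divide_eq)
  qed
  have "{x \<in> {- int B..<int B}. [x = c] (mod int q)} = (\<lambda>t. c + int q * t) ` {?lo..<?hi}"
  proof (intro equalityI subsetI)
    fix x assume x: "x \<in> {x \<in> {- int B..<int B}. [x = c] (mod int q)}"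
    then have "int q dvd x - c" by (simp add: cong_iff_dvd_diff)
    then obtain t where "x - c = int q * t" by (rule dvdE)
    then have "x = c + int q * t" by simp
    with x mem[of t] show "x \<in> (\<lambda>t. c + int q * t) ` {?lo..<?hi}" by blast
  next
    fix x assume "x \<in> (\<lambda>t. c + int q * t) ` {?lo..<?hi}"
    then obtain t where t: "t \<in> {?lo..<?hi}" "x = c + int q * t" by (rule imageE)
    then have "x \<in> {- int B..<int B}" using mem[of t] by simp
    moreover have "[x = c] (mod int q)" using t by (simp add: cong_iff_dvd_diff)
    ultimately show "x \<in> {x \<in> {- int B..<int B}. [x = c] (mod int q)}" by simp
  qed
  moreover have "inj_on (\<lambda>t. c + int q * t) {?lo..<?hi}"
    using assms by (auto simp: inj_on_def)
  ultimately have card: "card {x \<in> {- int B..<int B}. [x = c] (mod int q)} = nat (?hi - ?lo)"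
    by (simp add: card_image)
  have "?lo \<le> ?hi"
    by (intro ceiling_mono divide_right_mono) auto
  then have "real (card {x \<in> {- int B..<int B}. [x = c] (mod int q)}) = real_of_int ?hi - real_of_int ?lo"
    unfolding card by simp
  moreover have "(real B - real_of_int c) / real q - (- real B - real_of_int c) / real q = 2 * real B / real q"
    by (simp add: diff_divide_distrib[symmetric])
  moreover have "(real B - real_of_int c) / real q \<le> real_of_int ?hi"
    "real_of_int ?hi < (real B - real_of_int c) / real q + 1"
    "(- real B - real_of_int c) / real q \<le> real_of_int ?lo"
    "real_of_int ?lo < (- real B - real_of_int c) / real q + 1"
    by linarith+
  ultimately show ?thesis by linarith
qed

text \<open>The solutions fill at most one residue class. For \<open>p <= 2 * B\<close> the bound is
  of order \<open>B / p\<close>; for \<open>p > 2 * B\<close> it says that there is at most one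
  solution.\<close>

lemma card_linear_congruence:
  assumes p: "prime p" and a: "\<not> int p dvd a"
  shows "real (card {x \<in> {- int B..<int B}. int p dvd a * x + b}) < 2 * real B / real p + 1"
proof (cases "\<exists>x0. int p dvd a * x0 + b")
  case False
  then have *: "{x \<in> {- int B..<int B}. int p dvd a * x + b} = {}" by blast
  show ?thesis unfolding * by (simp add: add_nonneg_pos)
next
  case True
  then obtain x0 where x0: "int p dvd a * x0 + b" by blast
  have "{x \<in> {- int B..<int B}. int p dvd a * x + b} \<subseteq> {x \<in> {- int B..<int B}. [x = x0] (mod int p)}"
  proof clarsimp
    fix x assume "int p dvd a * x + b"
    from dvd_diff[OF this x0] have "int p dvd a * (x - x0)"
      by (simp add: algebra_simps)
    then show "[x = x0] (mod int p)"
      using a p by (simp add: prime_dvd_mult_iff cong_iff_dvd_diff)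
  qed
  then have "card {x \<in> {- int B..<int B}. int p dvd a * x + b} \<le> card {x \<in> {- int B..<int B}. [x = x0] (mod int p)}"
    by (intro card_mono finite_range_Collect)
  moreover have "real (card {x \<in> {- int B..<int B}. [x = x0] (mod int p)}) < 2 * real B / real p + 1"
    using card_residue_class[of p B x0] prime_gt_0_nat[OF p] by linarith
  ultimately show ?thesis by linarith
qed

section \<open>Periodic conditions and the Chinese remainder theorem\<close>

definition periodic :: "'i set \<Rightarrow> nat \<Rightarrow> (('i \<Rightarrow> int) \<Rightarrow> bool) \<Rightarrow> bool" where
  "periodic I q Q \<longleftrightarrow> (\<forall>f g. (\<forall>i\<in>I. [f i = g i] (mod int q)) \<longrightarrow> Q f = Q g)"

definition residues_sat :: "'i set \<Rightarrow> nat \<Rightarrow> (('i \<Rightarrow> int) \<Rightarrow> bool) \<Rightarrow> ('i \<Rightarrow> int) set" where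
  "residues_sat I q Q = {a \<in> PiE I (\<lambda>_. {0..<int q}). Q a}"

lemma periodicD: "periodic I q Q \<Longrightarrow> (\<And>i. i \<in> I \<Longrightarrow> [f i = g i] (mod int q)) \<Longrightarrow> Q f = Q g"
  unfolding periodic_def by simp

lemma finite_residues_sat: "finite I \<Longrightarrow> finite (residues_sat I q Q)"
  unfolding residues_sat_def by (simp add: finite_PiE)

text \<open>The residue vector of \<open>f\<close> decides \<open>Q f\<close>, and the points of the
  box with a given residue vector form a product of residue classes in intervals.\<close>

lemma cube_periodic_decomp:
  assumes "finite I" "q > 0" and Q: "periodic I q Q"
  shows "real (card {f \<in> PiE I (\<lambda>_. {- int B..<int B}). Q f})
    = (\<Sum>a\<in>residues_sat I q Q. \<Prod>i\<in>I. real (card {x \<in> {- int B..<int B}. [x = a i] (mod int q)}))"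
proof -
  let ?C = "\<lambda>a. PiE I (\<lambda>i. {x \<in> {- int B..<int B}. [x = a i] (mod int q)})"
  have "{f \<in> PiE I (\<lambda>_. {- int B..<int B}). Q f} = (\<Union>a\<in>residues_sat I q Q. ?C a)"
  proof (intro equalityI subsetI)
    fix f assume f: "f \<in> {f \<in> PiE I (\<lambda>_. {- int B..<int B}). Q f}"
    define a where "a = (\<lambda>i\<in>I. f i mod int q)"
    have "Q a = Q f"
      by (rule periodicD[OF Q]) (simp add: a_def cong_def)
    then have "a \<in> residues_sat I q Q"
      using f assms(2) by (simp add: residues_sat_def a_def)
    moreover have "f \<in> ?C a"
    proof (rule PiE_I)
      fix i assume "i \<in> I"
      moreover have "f i \<in> {- int B..<int B}"
        by (rule PiE_mem[OF _ \<open>i \<in> I\<close>]) (use f in blast)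
      ultimately show "f i \<in> {x \<in> {- int B..<int B}. [x = a i] (mod int q)}"
        by (simp add: a_def cong_def)
    next
      fix i assume "i \<notin> I"
      then show "f i = undefined" using f PiE_arb by auto
    qed
    ultimately show "f \<in> (\<Union>a\<in>residues_sat I q Q. ?C a)" by blast
  next
    fix f assume "f \<in> (\<Union>a\<in>residues_sat I q Q. ?C a)"
    then obtain a where a: "a \<in> residues_sat I q Q" "f \<in> ?C a" by (rule UN_E)
    have "[f i = a i] (mod int q)" if "i \<in> I" for i
      using PiE_mem[OF a(2) that] by simp
    then have "Q f = Q a" by (rule periodicD[OF Q])
    moreover have "Q a" using a(1) by (simp add: residues_sat_def)
    moreover have "f \<in> PiE I (\<lambda>_. {- int B..<int B})"
      using a(2) by (rule subsetD[OF PiE_mono, rotated]) blast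
    ultimately show "f \<in> {f \<in> PiE I (\<lambda>_. {- int B..<int B}). Q f}" by simp
  qed
  moreover have "card (\<Union>a\<in>residues_sat I q Q. ?C a) = (\<Sum>a\<in>residues_sat I q Q. card (?C a))"
  proof (rule card_UN_disjoint)
    show "\<forall>a\<in>residues_sat I q Q. \<forall>b\<in>residues_sat I q Q. a \<noteq> b \<longrightarrow> ?C a \<inter> ?C b = {}"
    proof (intro ballI impI)
      fix a b assume a: "a \<in> residues_sat I q Q" and b: "b \<in> residues_sat I q Q" and ne: "a \<noteq> b"
      show "?C a \<inter> ?C b = {}"
      proof (rule ccontr)
        assume "?C a \<inter> ?C b \<noteq> {}"
        then obtain f where f: "f \<in> ?C a" "f \<in> ?C b" by blast
        have a': "a \<in> PiE I (\<lambda>_. {0..<int q})" and b': "b \<in> PiE I (\<lambda>_. {0..<int q})"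
          using a b by (simp_all add: residues_sat_def)
        have "a = b"
        proof (rule PiE_ext[OF a' b'])
          fix i assume i: "i \<in> I"
          have "[a i = b i] (mod int q)"
            using PiE_mem[OF f(1) i] PiE_mem[OF f(2) i] by (simp add: cong_def)
          then show "a i = b i"
            using PiE_mem[OF a' i] PiE_mem[OF b' i] by (simp add: cong_def)
        qed
        with ne show False ..
      qed
    qed
    show "\<forall>a\<in>residues_sat I q Q. finite (?C a)"
      by (intro ballI finite_PiE finite_range_Collect assms(1))
  qed (rule finite_residues_sat[OF assms(1)])
  ultimately show ?thesis
    using assms(1) by (simp only: card_PiE of_nat_sum of_nat_prod)
qed

text \<open>After division by \<open>2 * B\<close> each one-dimensional count tends to
  \<open>1 / q\<close>, with error \<open>O(1 / B)\<close>; the decomposition is a finite sum of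
  finite products of such counts.\<close>

lemma periodic_density:
  assumes "finite I" "q > 0" and Q: "periodic I q Q"
  shows "(\<lambda>B. real (card {f \<in> PiE I (\<lambda>_. {- int B..<int B}). Q f}) / (2 * real B) ^ card I)
    \<longlonglongrightarrow> real (card (residues_sat I q Q)) / real q ^ card I"
proof -
  have "(\<lambda>B. (\<Sum>a\<in>residues_sat I q Q. \<Prod>i\<in>I.
          real (card {x \<in> {- int B..<int B}. [x = a i] (mod int q)}) / (2 * real B)))
    \<longlonglongrightarrow> (\<Sum>a\<in>residues_sat I q Q. \<Prod>i\<in>I. 1 / real q)"
  proof (intro tendsto_sum tendsto_prod)
    fix a :: "'a \<Rightarrow> int" and i
    let ?c = "\<lambda>B. real (card {x \<in> {- int B..<int B}. [x = a i] (mod int q)})"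
    have "(\<lambda>B. ?c B / (2 * real B) - 1 / real q) \<longlonglongrightarrow> 0"
    proof (rule tendsto_0_le[where K = 1])
      show "eventually (\<lambda>B. norm (?c B / (2 * real B) - 1 / real q) \<le> norm (1 / real B) * 1) sequentially"
      proof (rule eventually_sequentiallyI[of 1])
        fix B :: nat assume B: "1 \<le> B"
        have "?c B / (2 * real B) - 1 / real q = (?c B - 2 * real B / real q) / (2 * real B)"
          using B assms(2) by (simp add: field_simps)
        also have "\<bar>\<dots>\<bar> \<le> 1 / (2 * real B)"
          unfolding abs_divide using card_residue_class[OF assms(2), of B "a i"] B
          by (intro frac_le) auto
        also have "\<dots> \<le> 1 / real B" using B by (simp add: field_simps)
        finally show "norm (?c B / (2 * real B) - 1 / real q) \<le> norm (1 / real B) * 1" by simp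
      qed
      show "(\<lambda>B. 1 / real B) \<longlonglongrightarrow> 0" by (rule lim_1_over_n)
    qed
    then show "(\<lambda>B. ?c B / (2 * real B)) \<longlonglongrightarrow> 1 / real q" by (rule LIM_zero_cancel)
  qed
  moreover have "(\<Sum>a\<in>residues_sat I q Q. \<Prod>i\<in>I. 1 / real q)
      = real (card (residues_sat I q Q)) / real q ^ card I"
    by (simp add: divide_inverse power_inverse)
  moreover have "(\<lambda>B. real (card {f \<in> PiE I (\<lambda>_. {- int B..<int B}). Q f}) / (2 * real B) ^ card I)
    = (\<lambda>B. (\<Sum>a\<in>residues_sat I q Q. \<Prod>i\<in>I.
          real (card {x \<in> {- int B..<int B}. [x = a i] (mod int q)}) / (2 * real B)))"
    unfolding cube_periodic_decomp[OF assms] prod_dividef prod_constant sum_divide_distrib ..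
  ultimately show ?thesis by simp
qed

text \<open>Reduction modulo \<open>q\<close> and \<open>r\<close> is injective by coprimality, and
  both sides have the same number of elements, so it is a bijection. Periodicity makes
  \<open>P\<close> and \<open>Q\<close> conditions on the two components separately.\<close>

lemma card_residues_sat_mult:
  assumes "finite I" and "coprime q r" and "q > 0" "r > 0"
    and P: "periodic I q P" and Q: "periodic I r Q"
  shows "card (residues_sat I (q * r) (\<lambda>f. P f \<and> Q f)) = card (residues_sat I q P) * card (residues_sat I r Q)"
proof -
  let ?R = "\<lambda>q. PiE I (\<lambda>_. {0..<int q})"
  let ?h = "\<lambda>f. (\<lambda>i\<in>I. f i mod int q, \<lambda>i\<in>I. f i mod int r)"
  have inj: "inj_on ?h (?R (q * r))"
  proof (rule inj_onI)
    fix f g assume f: "f \<in> ?R (q * r)" and g: "g \<in> ?R (q * r)" and eq: "?h f = ?h g"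
    show "f = g"
    proof (rule PiE_ext[OF f g])
      fix i assume i: "i \<in> I"
      have "[f i = g i] (mod int q)" "[f i = g i] (mod int r)"
        using eq i by (auto simp: cong_def dest!: fun_cong[of _ _ i])
      then have "[f i = g i] (mod int q * int r)"
        using assms(2) by (intro coprime_cong_mult) auto
      then show "f i = g i"
        using PiE_mem[OF f i] PiE_mem[OF g i] by (simp add: cong_def)
    qed
  qed
  have sub: "?h ` ?R (q * r) \<subseteq> ?R q \<times> ?R r"
    using assms by auto
  have "card (?h ` ?R (q * r)) = card (?R (q * r))"
    by (rule card_image[OF inj])
  also have "\<dots> = card (?R q \<times> ?R r)"
    using assms(1) by (simp add: card_PiE card_cartesian_product power_mult_distrib nat_mult_distrib)
  finally have "card (?h ` ?R (q * r)) = card (?R q \<times> ?R r)" .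
  then have img: "?h ` ?R (q * r) = ?R q \<times> ?R r"
    using assms(1) by (intro card_subset_eq sub) (simp_all add: finite_PiE)
  have PQ: "P (fst (?h f)) = P f" "Q (snd (?h f)) = Q f" for f
    by (auto intro!: periodicD[OF P] periodicD[OF Q] simp: cong_def)
  have img': "?h ` residues_sat I (q * r) (\<lambda>f. P f \<and> Q f) = residues_sat I q P \<times> residues_sat I r Q"
  proof (intro equalityI subsetI)
    fix x assume "x \<in> ?h ` residues_sat I (q * r) (\<lambda>f. P f \<and> Q f)"
    then obtain f where f: "f \<in> ?R (q * r)" "P f" "Q f" "x = ?h f"
      unfolding residues_sat_def by blast
    then have "x \<in> ?R q \<times> ?R r" using sub by blast
    moreover have "P (fst x)" "Q (snd x)" using f PQ[of f] by simp_all
    ultimately show "x \<in> residues_sat I q P \<times> residues_sat I r Q"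
      unfolding residues_sat_def by auto
  next
    fix x assume x: "x \<in> residues_sat I q P \<times> residues_sat I r Q"
    then have "x \<in> ?h ` ?R (q * r)" unfolding img residues_sat_def by auto
    then obtain f where f: "f \<in> ?R (q * r)" "x = ?h f" by blast
    have "P (fst x)" "Q (snd x)" using x unfolding residues_sat_def by auto
    then have "P f" "Q f" using PQ[of f] unfolding f(2) by simp_all
    with f(1) have "f \<in> residues_sat I (q * r) (\<lambda>f. P f \<and> Q f)"
      by (simp add: residues_sat_def)
    with f(2) show "x \<in> ?h ` residues_sat I (q * r) (\<lambda>f. P f \<and> Q f)"
      by (rule image_eqI)
  qed
  have inj': "inj_on ?h (residues_sat I (q * r) (\<lambda>f. P f \<and> Q f))"
    by (rule inj_on_subset[OF inj]) (auto simp: residues_sat_def)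
  show ?thesis
    unfolding card_image[OF inj', symmetric] img' by (rule card_cartesian_product)
qed

section \<open>Full-rank matrices modulo primes\<close>

text \<open>The rows that destroy independence are those in the span of the \<open>k\<close>
  independent ones: the coefficient of the new row in a dependence is invertible modulo
  \<open>p\<close>, so the dependence can be solved for that row.\<close>

lemma dependent_rows_eq_image:
  assumes p: "prime p" and nd: "\<not> row_dependent p k m f"
  shows "{r \<in> PiE {..<m} (\<lambda>_. {0..<int p}). row_dependent p (Suc k) m (\<lambda>(i, j). if i = k then r j else f (i, j))}
    = row_comb p k m f ` PiE {..<k} (\<lambda>_. {0..<int p})"
proof (intro equalityI subsetI)
  have p0: "int p > 0" using prime_gt_0_nat[OF p] by simp
  fix r assume "r \<in> {r \<in> PiE {..<m} (\<lambda>_. {0..<int p}). row_dependent p (Suc k) m (\<lambda>(i, j). if i = k then r j else f (i, j))}"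
  then have r: "r \<in> PiE {..<m} (\<lambda>_. {0..<int p})"
    and d: "row_dependent p (Suc k) m (\<lambda>(i, j). if i = k then r j else f (i, j))" by simp_all
  obtain u where u: "\<exists>i<Suc k. \<not> int p dvd u i"
    "\<forall>j<m. int p dvd (\<Sum>i<Suc k. u i * (case (i, j) of (i, j) \<Rightarrow> if i = k then r j else f (i, j)))"
    using d by (rule row_dependentE)
  have u2: "int p dvd (\<Sum>i<k. u i * f (i, j)) + u k * r j" if "j < m" for j
    using u(2) that by simp
  have "\<not> int p dvd u k"
  proof
    assume uk: "int p dvd u k"
    then have "\<exists>i<k. \<not> int p dvd u i" using u(1) less_Suc_eq by auto
    moreover have "int p dvd (\<Sum>i<k. u i * f (i, j))" if "j < m" for j
      using u2[OF that] uk by (simp add: dvd_add_left_iff)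
    ultimately show False using nd row_dependentI[of k p u m f] by simp
  qed
  then have "coprime (u k) (int p)"
    using p by (simp add: coprime_commute prime_imp_coprime)
  then obtain t where t: "[u k * t = 1] (mod int p)"
    using cong_solve_coprime_int by blast
  \<comment> \<open>Solving for the new row: \<open>t\<close> inverts \<open>u k\<close>, so the row
    is congruent to \<open>- t\<close> times the combination of the others with coefficients
    \<open>u i\<close>.\<close>
  define v where "v = (\<lambda>i\<in>{..<k}. (- t * u i) mod int p)"
  have v: "v \<in> PiE {..<k} (\<lambda>_. {0..<int p})"
    using p0 by (auto simp: v_def)
  have "row_comb p k m f v = r"
  proof (rule PiE_ext)
    show "row_comb p k m f v \<in> PiE {..<m} (\<lambda>_. {0..<int p})"
      using row_comb_image[of p k m f "{v}"] p0 by simp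
    show "r \<in> PiE {..<m} (\<lambda>_. {0..<int p})" by (rule r)
    fix j assume j: "j \<in> {..<m}"
    have "[(\<Sum>i<k. v i * f (i, j)) = (\<Sum>i<k. (- t * u i) * f (i, j))] (mod int p)"
      by (intro cong_sum cong_mult cong_refl) (simp add: v_def)
    also have "(\<Sum>i<k. (- t * u i) * f (i, j)) = - t * ((\<Sum>i<k. u i * f (i, j)) + u k * r j) + (u k * t) * r j"
      by (simp add: sum_distrib_left algebra_simps sum_negf)
    also have "[\<dots> = 0 + 1 * r j] (mod int p)"
    proof (intro cong_add cong_mult cong_refl t)
      show "[- t * ((\<Sum>i<k. u i * f (i, j)) + u k * r j) = 0] (mod int p)"
        unfolding cong_0_iff by (rule dvd_mult) (rule u2, use j in simp)
    qed
    finally show "row_comb p k m f v j = r j"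
      using j PiE_mem[OF r j] by (simp add: row_comb_def cong_def)
  qed
  with v show "r \<in> row_comb p k m f ` PiE {..<k} (\<lambda>_. {0..<int p})" by blast
next
  have p0: "p > 0" "\<not> int p dvd 1" using prime_gt_1_nat[OF p] by simp_all
  fix r assume "r \<in> row_comb p k m f ` PiE {..<k} (\<lambda>_. {0..<int p})"
  then obtain v where v: "r = row_comb p k m f v" by (rule imageE)
  have "r \<in> PiE {..<m} (\<lambda>_. {0..<int p})"
    unfolding v using row_comb_image[of p k m f "{v}"] p0 by simp
  moreover have "row_dependent p (Suc k) m (\<lambda>(i, j). if i = k then r j else f (i, j))"
  proof (rule row_dependentI[of _ _ "\<lambda>i. if i = k then - 1 else v i"])
    show "\<exists>i<Suc k. \<not> int p dvd (if i = k then - 1 else v i)"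
      using p0 by (intro exI[of _ k]) simp
    fix j assume j: "j < m"
    have "(\<Sum>i<Suc k. (if i = k then - 1 else v i) * (case (i, j) of (i, j) \<Rightarrow> if i = k then r j else f (i, j)))
        = (\<Sum>i<k. v i * f (i, j)) - (\<Sum>i<k. v i * f (i, j)) mod int p"
      using j by (simp add: v row_comb_def)
    then show "int p dvd (\<Sum>i<Suc k. (if i = k then - 1 else v i) * (case (i, j) of (i, j) \<Rightarrow> if i = k then r j else f (i, j)))"
      by (simp only: dvd_minus_mod)
  qed
  ultimately show "r \<in> {r \<in> PiE {..<m} (\<lambda>_. {0..<int p}). row_dependent p (Suc k) m (\<lambda>(i, j). if i = k then r j else f (i, j))}"
    by simp
qed

lemma card_independent_rows:
  assumes p: "prime p" and nd: "\<not> row_dependent p k m f"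
  shows "card {r \<in> PiE {..<m} (\<lambda>_. {0..<int p}).
      \<not> row_dependent p (Suc k) m (\<lambda>(i, j). if i = k then r j else f (i, j))} = p ^ m - p ^ k"
proof -
  let ?S = "PiE {..<m} (\<lambda>_. {0..<int p})"
  let ?D = "{r \<in> ?S. row_dependent p (Suc k) m (\<lambda>(i, j). if i = k then r j else f (i, j))}"
  have "{r \<in> ?S. \<not> row_dependent p (Suc k) m (\<lambda>(i, j). if i = k then r j else f (i, j))} = ?S - ?D"
    by blast
  moreover have "card (?S - ?D) = card ?S - card ?D"
    by (rule card_Diff_subset) (auto intro: finite_subset[of _ ?S] simp: finite_PiE)
  moreover have "card ?D = p ^ k"
    unfolding dependent_rows_eq_image[OF assms] card_image[OF inj_on_row_comb[OF nd]]
    by (simp add: card_PiE)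
  ultimately show ?thesis by (simp add: card_PiE)
qed

text \<open>Induction on the number \<open>k\<close> of rows required to be independent, within a
  fixed space of \<open>n\<close> by \<open>m\<close> matrices. Given the first \<open>k\<close>
  rows, a proportion \<open>p ^ k / p ^ m\<close> of the choices for the next row lies in their
  span.\<close>

lemma card_independent_matrices:
  assumes p: "prime p" and "k \<le> n" "n \<le> m"
  shows "real (card {f \<in> PiE ({..<n} \<times> {..<m}) (\<lambda>_. {0..<int p}). \<not> row_dependent p k m f}) / real p ^ (n * m)
    = (\<Prod>i<k. 1 - 1 / real p ^ (m - i))"
  using \<open>k \<le> n\<close>
proof (induction k)
  case 0
  then show ?case
    using prime_gt_0_nat[OF p] by (simp add: card_PiE)
next
  case (Suc k)
  let ?\<Omega> = "PiE ({..<n} \<times> {..<m}) (\<lambda>_. {0..<int p})"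
  let ?S = "PiE {..<m} (\<lambda>_. {0..<int p})"
  let ?Y = "{f \<in> ?\<Omega>. \<not> row_dependent p k m f}"
  let ?X = "{f \<in> ?\<Omega>. \<not> row_dependent p (Suc k) m f}"
  \<comment> \<open>The lens reads and overwrites the whole row \<open>k\<close>; the restrictions
    keep rows and matrices extensional.\<close>
  let ?get = "\<lambda>f. \<lambda>j\<in>{..<m}. f (k, j) :: int"
  let ?upd = "\<lambda>f r. \<lambda>ij\<in>{..<n} \<times> {..<m}. if fst ij = k then r (snd ij) else f ij :: int"
  have p0: "real p > 0" using prime_gt_0_nat[OF p] by simp
  have k: "k < n" using Suc.prems by simp
  have dep_upd: "row_dependent p (Suc k) m (?upd f r)
      \<longleftrightarrow> row_dependent p (Suc k) m (\<lambda>(i, j). if i = k then r j else f (i, j))" for f r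
    by (rule row_dependent_cong) (use k in auto)
  have dep_upd': "row_dependent p k m (?upd f r) \<longleftrightarrow> row_dependent p k m f" for f r
    by (rule row_dependent_cong) (use k in auto)
  have upd_in: "?upd f r \<in> ?\<Omega>" if "f \<in> ?\<Omega>" "r \<in> ?S" for f r
  proof (rule restrict_PiE_iff[THEN iffD2], rule ballI)
    fix ij assume ij: "ij \<in> {..<n} \<times> {..<m}"
    then show "(if fst ij = k then r (snd ij) else f ij) \<in> {0..<int p}"
      using PiE_mem[OF that(1) ij] PiE_mem[OF that(2), of "snd ij"] by (auto simp: mem_Times_iff)
  qed
  have "card ?X * card ?S = (\<Sum>f\<in>?Y. card {r \<in> ?S. ?upd f r \<in> ?X})"
  proof (rule card_fibers[where get = ?get])
    show "finite ?Y" by (rule finite_subset[of _ ?\<Omega>]) (auto simp: finite_PiE)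
    show "finite ?S" by (simp add: finite_PiE)
    show "?X \<subseteq> ?Y" using row_dependent_mono_rows[of p k m _ "Suc k"] by auto
    fix f r assume f: "f \<in> ?Y"
    then have f\<Omega>: "f \<in> ?\<Omega>" by simp
    show "?get f \<in> ?S"
      using PiE_mem[OF f\<Omega>] k by (intro restrict_PiE_iff[THEN iffD2] ballI) auto
    show "?upd f (?get f) = f"
    proof
      fix ij show "?upd f (?get f) ij = f ij"
        using PiE_arb[OF f\<Omega>, of ij] by (cases ij) auto
    qed
    assume r: "r \<in> ?S"
    show "?upd f r \<in> ?Y"
      using upd_in[OF f\<Omega> r] f dep_upd' by blast
    show "?get (?upd f r) = r"
    proof
      fix j show "?get (?upd f r) j = r j"
        using k PiE_arb[OF r, of j] by (cases "j < m") auto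
    qed
    fix s
    show "?upd (?upd f r) s = ?upd f s" by (rule ext) auto
  qed
  also have "\<dots> = (\<Sum>f\<in>?Y. p ^ m - p ^ k)"
  proof (rule sum.cong[OF refl])
    fix f assume f: "f \<in> ?Y"
    have "{r \<in> ?S. ?upd f r \<in> ?X}
        = {r \<in> ?S. \<not> row_dependent p (Suc k) m (\<lambda>(i, j). if i = k then r j else f (i, j))}"
      using f upd_in[of f] dep_upd[where f = f] by blast
    then show "card {r \<in> ?S. ?upd f r \<in> ?X} = p ^ m - p ^ k"
      using card_independent_rows[OF p, of k m f] f by simp
  qed
  finally have "card ?X * p ^ m = card ?Y * (p ^ m - p ^ k)"
    by (simp add: card_PiE)
  from arg_cong[OF this, of real]
  have "real (card ?X) * real p ^ m = real (card ?Y) * real (p ^ m - p ^ k)"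
    by (simp only: of_nat_mult of_nat_power)
  also have "real (p ^ m - p ^ k) = real p ^ m - real p ^ k"
    using k assms(3) prime_ge_1_nat[OF p] by (simp add: of_nat_diff power_increasing)
  also have "real p ^ m - real p ^ k = (1 - 1 / real p ^ (m - k)) * real p ^ m"
    using k assms(3) p0 by (simp add: field_simps flip: power_add)
  finally have "real (card ?X) = real (card ?Y) * (1 - 1 / real p ^ (m - k))"
    using p0 by simp
  then have "real (card ?X) / real p ^ (n * m)
      = real (card ?Y) / real p ^ (n * m) * (1 - 1 / real p ^ (m - k))"
    by simp
  also have "real (card ?Y) / real p ^ (n * m) = (\<Prod>i<k. 1 - 1 / real p ^ (m - i))"
    by (rule Suc.IH) (use Suc.prems in simp)
  finally show ?case by simp
qed

lemma periodic_row_dependent: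
  assumes "p dvd q"
  shows "periodic ({..<n} \<times> {..<m}) q (\<lambda>f. \<not> row_dependent p n m f)"
  unfolding periodic_def
proof (intro allI impI)
  fix f g :: "nat \<times> nat \<Rightarrow> int"
  assume "\<forall>i\<in>{..<n} \<times> {..<m}. [f i = g i] (mod int q)"
  then have "[f (i, j) = g (i, j)] (mod int q)" if "i < n" "j < m" for i j
    using that by simp
  then have "[f (i, j) = g (i, j)] (mod int p)" if "i < n" "j < m" for i j
    by (rule cong_dvd_modulus) (use that assms in simp_all)
  then have "row_dependent p n m f = row_dependent p n m g"
    by (rule row_dependent_cong)
  then show "(\<not> row_dependent p n m f) = (\<not> row_dependent p n m g)"
    by (rule arg_cong)
qed

text \<open>Induction on the set of primes: the Chinese remainder theorem makes the conditions at
  different primes independent, and each prime contributes its proportion of full-rank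
  matrices.\<close>

lemma independent_residues_density:
  assumes "n \<le> m" and "finite A" and "\<And>p. p \<in> A \<Longrightarrow> prime p"
  shows "real (card (residues_sat ({..<n} \<times> {..<m}) (\<Prod>A) (\<lambda>f. \<forall>p\<in>A. \<not> row_dependent p n m f)))
      / real (\<Prod>A) ^ (n * m) = (\<Prod>p\<in>A. \<Prod>i<n. 1 - 1 / real p ^ (m - i))"
  using assms(2,3)
proof (induction A rule: finite_induct)
  case empty
  then show ?case by (simp add: residues_sat_def card_PiE)
next
  case (insert p A)
  let ?I = "{..<n} \<times> {..<m}"
  have p: "prime p" using insert.prems by simp
  have cop: "coprime p (\<Prod>A)"
    using insert by (intro prod_coprime_right) (metis insertCI primes_coprime)
  have pos: "\<Prod>A > 0" "p > 0"
    using insert.prems prime_gt_0_nat by (auto intro: prod_pos)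
  have per: "periodic ?I (\<Prod>A) (\<lambda>f. \<forall>q\<in>A. \<not> row_dependent q n m f)"
    unfolding periodic_def
    using periodic_row_dependent[of _ "\<Prod>A" n m, unfolded periodic_def] insert.hyps(1)
    by (meson dvd_prodI)
  have "(\<lambda>f. \<forall>q\<in>insert p A. \<not> row_dependent q n m f)
      = (\<lambda>f. \<not> row_dependent p n m f \<and> (\<forall>q\<in>A. \<not> row_dependent q n m f))"
    by auto
  then have "card (residues_sat ?I (\<Prod>(insert p A)) (\<lambda>f. \<forall>q\<in>insert p A. \<not> row_dependent q n m f))
    = card (residues_sat ?I p (\<lambda>f. \<not> row_dependent p n m f))
      * card (residues_sat ?I (\<Prod>A) (\<lambda>f. \<forall>q\<in>A. \<not> row_dependent q n m f))"
    using insert.hyps pos cop per periodic_row_dependent[of p p n m]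
    by (simp add: card_residues_sat_mult)
  moreover have "real (card (residues_sat ?I p (\<lambda>f. \<not> row_dependent p n m f))) / real p ^ (n * m)
      = (\<Prod>i<n. 1 - 1 / real p ^ (m - i))"
    unfolding residues_sat_def by (rule card_independent_matrices[OF p order_refl assms(1)])
  moreover have "real (card (residues_sat ?I (\<Prod>A) (\<lambda>f. \<forall>q\<in>A. \<not> row_dependent q n m f)))
      / real (\<Prod>A) ^ (n * m) = (\<Prod>p\<in>A. \<Prod>i<n. 1 - 1 / real p ^ (m - i))"
    using insert.IH insert.prems by simp
  ultimately show ?case
    using insert.hyps by (simp add: power_mult_distrib flip: times_divide_times_eq)
qed

section \<open>Dependence modulo a large prime\<close>

lemma card_int_range: "real (card {- int B..<int B}) = 2 * real B"
  by simp

lemma cube_fun_upd: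
  assumes "f \<in> PiE I (\<lambda>_. S)" "x \<in> S" "i \<in> I"
  shows "f(i := x) \<in> PiE I (\<lambda>_. S)"
  using assms by (auto simp: PiE_def Pi_def extensional_def)

text \<open>By \<open>row_hyperplane\<close>, row \<open>k\<close> satisfies a linear congruence
  whose coefficients depend on the earlier rows. Varying one entry of that row at which the
  coefficient is invertible gives the saving. The bound holds for every prime, and with a prime
  above \<open>2 * B\<close> it will also control vanishing minors.\<close>

lemma card_square_dependent_le:
  fixes n m k p B :: nat
  defines "\<Omega> \<equiv> PiE ({..<n} \<times> {..<m}) (\<lambda>_. {- int B..<int B})"
  assumes p: "prime p" and k: "k < n" "k < m"
  shows "real (card {f \<in> \<Omega>. \<not> row_dependent p k (Suc k) f \<and> row_dependent p (Suc k) (Suc k) f}) * (2 * real B)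
    \<le> (2 * real B / real p + 1) * real (card \<Omega>)"
proof -
  let ?S = "{- int B..<int B}"
  let ?Y = "{f \<in> \<Omega>. \<not> row_dependent p k (Suc k) f}"
  let ?X = "{f \<in> \<Omega>. \<not> row_dependent p k (Suc k) f \<and> row_dependent p (Suc k) (Suc k) f}"
  \<comment> \<open>The column \<open>j\<close> of the entry to vary must not change with the entry, so \<open>good\<close> refers to \<open>f\<close> only
    through its first \<open>k\<close> rows.\<close>
  define good where "good f j \<longleftrightarrow> j < Suc k \<and> (\<exists>w. \<not> int p dvd w j \<and>
      (\<forall>g. (\<forall>i<k. \<forall>j<Suc k. g (i, j) = f (i, j)) \<longrightarrow> row_dependent p (Suc k) (Suc k) g \<longrightarrow>
              int p dvd (\<Sum>j<Suc k. g (k, j) * w j)))" for f :: "nat \<times> nat \<Rightarrow> int" and j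
  define sel where "sel f = (k, SOME j. good f j)" for f
  have good: "good f (snd (sel f))" if nd: "\<not> row_dependent p k (Suc k) f" for f
  proof -
    obtain w where "\<exists>j<Suc k. \<not> int p dvd w j" "\<forall>g. (\<forall>i<k. \<forall>j<Suc k. g (i, j) = f (i, j)) \<longrightarrow>
      row_dependent p (Suc k) (Suc k) g \<longrightarrow> int p dvd (\<Sum>j<Suc k. g (k, j) * w j)"
      by (rule row_hyperplane[OF p lessI nd])
    then have "\<exists>j. good f j" unfolding good_def by (elim exE conjE) (intro exI conjI)
    then show ?thesis unfolding sel_def snd_conv by (rule someI_ex)
  qed
  have good_upd: "good (f((k, j) := x)) = good f" for f j x
    unfolding good_def by simp
  have sel_upd: "sel (f(sel f := x)) = sel f" for f x
    unfolding sel_def good_upd ..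
  have dep_upd: "row_dependent p k (Suc k) (f(sel f := x)) = row_dependent p k (Suc k) f" for f x
    by (rule row_dependent_cong) (auto simp: sel_def)
  have sel_in: "sel f \<in> {..<n} \<times> {..<m}" if "\<not> row_dependent p k (Suc k) f" for f
    using good[OF that] k unfolding good_def by (simp add: sel_def)
  have fin: "finite \<Omega>" unfolding \<Omega>_def by (simp add: finite_PiE)
  have "real (card ?X) * real (card ?S) \<le> (2 * real B / real p + 1) * real (card ?Y)"
  proof (rule card_fibers_le[where get = "\<lambda>f. f (sel f)" and upd = "\<lambda>f x. f(sel f := x)"])
    show "finite ?Y" using fin by simp
    show "finite ?S" by simp
    show "?X \<subseteq> ?Y" by blast
    fix f assume f: "f \<in> ?Y"
    show "f (sel f) \<in> ?S"
      by (rule PiE_mem[of f "{..<n} \<times> {..<m}"]) (use f sel_in[of f] in \<open>simp_all add: \<Omega>_def\<close>)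
    show "f(sel f := f (sel f)) = f" by simp
    fix x assume x: "x \<in> ?S"
    show "f(sel f := x) \<in> ?Y"
      using f x dep_upd[of f x] sel_in[of f] cube_fun_upd[of f "{..<n} \<times> {..<m}" ?S x "sel f"]
      unfolding \<Omega>_def by simp
    show "(f(sel f := x)) (sel (f(sel f := x))) = x"
      by (simp only: sel_upd fun_upd_same)
    fix y show "(f(sel f := x))(sel (f(sel f := x)) := y) = f(sel f := y)"
      by (simp only: sel_upd fun_upd_upd)
  next
    fix f assume f: "f \<in> ?Y"
    define j0 where "j0 = snd (sel f)"
    have "good f j0" using good[of f] f by (simp add: j0_def)
    then obtain w where j0: "j0 < Suc k" and w: "\<not> int p dvd w j0"
      "\<forall>g. (\<forall>i<k. \<forall>j<Suc k. g (i, j) = f (i, j)) \<longrightarrow> row_dependent p (Suc k) (Suc k) g \<longrightarrow>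
              int p dvd (\<Sum>j<Suc k. g (k, j) * w j)"
      unfolding good_def by (elim exE conjE)
    have sel: "sel f = (k, j0)" by (simp add: j0_def sel_def)
    define b where "b = (\<Sum>j\<in>{..<Suc k} - {j0}. f (k, j) * w j)"
    have "int p dvd w j0 * x + b" if "row_dependent p (Suc k) (Suc k) (f(sel f := x))" for x
    proof -
      have "int p dvd (\<Sum>j<Suc k. (f(sel f := x)) (k, j) * w j)"
        by (rule w(2)[rule_format, OF _ that]) (simp add: sel)
      also have "(\<Sum>j<Suc k. (f(sel f := x)) (k, j) * w j)
          = (f(sel f := x)) (k, j0) * w j0 + (\<Sum>j\<in>{..<Suc k} - {j0}. (f(sel f := x)) (k, j) * w j)"
        by (rule sum.remove) (use j0 in auto)
      also have "\<dots> = w j0 * x + b"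
        unfolding b_def sel by (simp add: mult.commute)
      finally show ?thesis .
    qed
    then have "{x \<in> ?S. f(sel f := x) \<in> ?X} \<subseteq> {x \<in> ?S. int p dvd w j0 * x + b}"
      by blast
    then have "card {x \<in> ?S. f(sel f := x) \<in> ?X} \<le> card {x \<in> ?S. int p dvd w j0 * x + b}"
      by (intro card_mono finite_range_Collect)
    then show "real (card {x \<in> ?S. f(sel f := x) \<in> ?X}) \<le> 2 * real B / real p + 1"
      using card_linear_congruence[OF p w(1), of B b] by linarith
  qed
  also have "\<dots> \<le> (2 * real B / real p + 1) * real (card \<Omega>)"
    using fin by (intro mult_left_mono of_nat_mono card_mono) auto
  finally show ?thesis by (simp only: card_int_range)
qed

text \<open>\<open>column_hyperplane\<close> is a linear congruence for the entry
  \<open>(k, l)\<close> with leading coefficient \<open>u k\<close>, which is invertible modulo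
  \<open>p\<close>.\<close>

lemma card_last_entry:
  assumes p: "prime p" and "\<not> row_dependent p k l f" "row_dependent p (Suc k) l f"
  shows "real (card {x \<in> {- int B..<int B}. row_dependent p (Suc k) (Suc l) (f((k, l) := x))})
    < 2 * real B / real p + 1"
proof -
  obtain u where u: "\<not> int p dvd u k" "\<forall>g. (\<forall>i<Suc k. \<forall>j<l. g (i, j) = f (i, j)) \<longrightarrow>
      row_dependent p (Suc k) (Suc l) g \<longrightarrow> int p dvd (\<Sum>i<Suc k. u i * g (i, l))"
    by (rule column_hyperplane[OF assms])
  define b where "b = (\<Sum>i<k. u i * f (i, l))"
  have "int p dvd u k * x + b" if "row_dependent p (Suc k) (Suc l) (f((k, l) := x))" for x
  proof -
    have "int p dvd (\<Sum>i<Suc k. u i * (f((k, l) := x)) (i, l))"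
      by (rule u(2)[rule_format, OF _ that]) simp
    then show ?thesis by (simp add: b_def add.commute)
  qed
  then have "{x \<in> {- int B..<int B}. row_dependent p (Suc k) (Suc l) (f((k, l) := x))}
      \<subseteq> {x \<in> {- int B..<int B}. int p dvd u k * x + b}"
    by blast
  then have "card {x \<in> {- int B..<int B}. row_dependent p (Suc k) (Suc l) (f((k, l) := x))}
      \<le> card {x \<in> {- int B..<int B}. int p dvd u k * x + b}"
    by (intro card_mono finite_range_Collect)
  then show ?thesis
    using card_linear_congruence[OF p u(1), of B b] by linarith
qed

text \<open>The right-hand side keeps the condition \<open>Q\<close>, which does not involve the
  varied entry, so that a further saving can be drawn from \<open>Q\<close>.\<close>

lemma card_last_entry_fibers_le:
  fixes n m k B :: nat
  defines "\<Omega> \<equiv> PiE ({..<n} \<times> {..<m}) (\<lambda>_. {- int B..<int B})"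
  assumes k: "k < n" "l < m" and XY: "X \<subseteq> {f \<in> \<Omega>. Q f}"
    and Q: "\<And>f x. Q (f((k, l) := x)) = Q f"
    and K: "\<And>f. Q f \<Longrightarrow> f \<in> \<Omega> \<Longrightarrow> real (card {x \<in> {- int B..<int B}. f((k, l) := x) \<in> X}) \<le> K"
  shows "real (card X) * (2 * real B) \<le> K * real (card {f \<in> \<Omega>. Q f})"
proof -
  let ?S = "{- int B..<int B}"
  let ?Y = "{f \<in> \<Omega>. Q f}"
  have fin: "finite \<Omega>" unfolding \<Omega>_def by (simp add: finite_PiE)
  have "real (card X) * real (card ?S) \<le> K * real (card ?Y)"
  proof (rule card_fibers_le[where get = "\<lambda>f. f (k, l)" and upd = "\<lambda>f x. f((k, l) := x)"])
    show "finite ?Y" using fin by simp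
    show "finite ?S" by simp
    show "X \<subseteq> ?Y" by (rule XY)
    fix f assume f: "f \<in> ?Y"
    show "f (k, l) \<in> ?S"
      by (rule PiE_mem[of f "{..<n} \<times> {..<m}"]) (use f k in \<open>simp_all add: \<Omega>_def\<close>)
    show "f((k, l) := f (k, l)) = f" by simp
    show "real (card {x \<in> ?S. f((k, l) := x) \<in> X}) \<le> K"
      using f by (intro K) auto
    fix x assume x: "x \<in> ?S"
    show "f((k, l) := x) \<in> ?Y"
      using f x k cube_fun_upd[of f "{..<n} \<times> {..<m}" ?S x "(k, l)"]
      unfolding \<Omega>_def by (simp add: Q)
    show "(f((k, l) := x)) (k, l) = x" by simp
    fix y show "(f((k, l) := x))((k, l) := y) = f((k, l) := y)" by simp
  qed
  then show ?thesis by (simp only: card_int_range)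
qed

text \<open>Two savings multiply. The entry \<open>(k, k + 1)\<close> is confined by the column
  congruence, and the remaining condition \<open>?Q\<close>, which ignores that entry, is bounded by
  \<open>card_square_dependent_le\<close>. The square is what makes the sum over \<open>p\<close>
  converge.\<close>

lemma card_dependent_le:
  fixes n m k p B :: nat
  defines "\<Omega> \<equiv> PiE ({..<n} \<times> {..<m}) (\<lambda>_. {- int B..<int B})"
  assumes p: "prime p" and k: "k < n" "Suc k < m" and B: "B > 0"
  shows "real (card {f \<in> \<Omega>. \<not> row_dependent p k (Suc k) f \<and> row_dependent p (Suc k) (Suc (Suc k)) f})
    \<le> (1 / real p + 1 / (2 * real B))\<^sup>2 * real (card \<Omega>)"
proof -
  let ?Q = "\<lambda>f. \<not> row_dependent p k (Suc k) f \<and> row_dependent p (Suc k) (Suc k) f"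
  let ?X = "{f \<in> \<Omega>. \<not> row_dependent p k (Suc k) f \<and> row_dependent p (Suc k) (Suc (Suc k)) f}"
  let ?c = "2 * real B / real p + 1"
  have c0: "?c \<ge> 0" by simp
  have "real (card ?X) * (2 * real B) \<le> ?c * real (card {f \<in> \<Omega>. ?Q f})"
    unfolding \<Omega>_def
  proof (rule card_last_entry_fibers_le[OF k])
    show "{f \<in> PiE ({..<n} \<times> {..<m}) (\<lambda>_. {- int B..<int B}).
        \<not> row_dependent p k (Suc k) f \<and> row_dependent p (Suc k) (Suc (Suc k)) f}
      \<subseteq> {f \<in> PiE ({..<n} \<times> {..<m}) (\<lambda>_. {- int B..<int B}). ?Q f}"
      using row_dependent_mono_cols[of p "Suc k" "Suc (Suc k)" _ "Suc k"] by auto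
    fix f :: "nat \<times> nat \<Rightarrow> int" and x
    have "row_dependent p k' (Suc k) (f((k, Suc k) := x)) = row_dependent p k' (Suc k) f" for k'
      by (rule row_dependent_cong) auto
    then show "?Q (f((k, Suc k) := x)) = ?Q f" by simp
  next
    fix f assume "?Q f"
    then have "real (card {x \<in> {- int B..<int B}. row_dependent p (Suc k) (Suc (Suc k)) (f((k, Suc k) := x))}) < ?c"
      by (intro card_last_entry[OF p]) simp_all
    moreover have "card {x \<in> {- int B..<int B}. f((k, Suc k) := x) \<in> {f \<in> PiE ({..<n} \<times> {..<m}) (\<lambda>_. {- int B..<int B}).
        \<not> row_dependent p k (Suc k) f \<and> row_dependent p (Suc k) (Suc (Suc k)) f}}
      \<le> card {x \<in> {- int B..<int B}. row_dependent p (Suc k) (Suc (Suc k)) (f((k, Suc k) := x))}"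
      by (rule card_mono[OF finite_range_Collect]) blast
    ultimately show "real (card {x \<in> {- int B..<int B}. f((k, Suc k) := x) \<in> {f \<in> PiE ({..<n} \<times> {..<m}) (\<lambda>_. {- int B..<int B}).
        \<not> row_dependent p k (Suc k) f \<and> row_dependent p (Suc k) (Suc (Suc k)) f}}) \<le> ?c"
      by linarith
  qed
  then have "real (card ?X) * (2 * real B) * (2 * real B) \<le> ?c * real (card {f \<in> \<Omega>. ?Q f}) * (2 * real B)"
    by (rule mult_right_mono) simp
  also have "\<dots> \<le> ?c * (?c * real (card \<Omega>))"
    using mult_left_mono[OF card_square_dependent_le[OF p k(1), of m B] c0] k(2)
    by (simp only: \<Omega>_def mult.assoc Suc_lessD)
  also have "\<dots> = (1 / real p + 1 / (2 * real B))\<^sup>2 * real (card \<Omega>) * (2 * real B) * (2 * real B)"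
  proof -
    have "?c = (1 / real p + 1 / (2 * real B)) * (2 * real B)"
      using B by (simp add: field_simps)
    then show ?thesis by (simp only: power2_eq_square mult_ac)
  qed
  finally show ?thesis
    using B by simp
qed

section \<open>Primes larger than the box\<close>

lemma card_prime_divisors_less:
  fixes b d e :: nat
  assumes "finite A" "\<And>p. p \<in> A \<Longrightarrow> prime p \<and> p dvd d \<and> b \<le> p" and "0 < d" "d < b ^ e" "1 < b"
  shows "card A < e"
proof -
  have "\<Prod>A dvd d"
    using assms(1,2)
  proof (induction A rule: finite_induct)
    case (insert p A)
    then have "coprime p (\<Prod>A)"
      by (intro prod_coprime_right) (metis insertCI primes_coprime)
    with insert show ?case by (simp add: divides_mult)
  qed simp
  then have "\<Prod>A \<le> d" using assms(3) by (rule dvd_imp_le)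
  moreover have "b ^ card A \<le> \<Prod>A"
    using prod_mono[of A "\<lambda>_. b" "\<lambda>p. p"] assms(2) by simp
  ultimately have "b ^ card A < b ^ e" using assms(4) by linarith
  then show ?thesis using assms(5) by (rule power_less_imp_less_exp[rotated])
qed

lemma abs_det_le:
  assumes "\<And>i j. i < k \<Longrightarrow> j < k \<Longrightarrow> \<bar>f (i, j)\<bar> \<le> int B"
  shows "\<bar>det (mat k k f)\<bar> \<le> fact k * int B ^ k"
proof -
  let ?P = "{\<pi>. \<pi> permutes {0..<k}}"
  have "\<bar>det (mat k k f)\<bar> = \<bar>\<Sum>\<pi>\<in>?P. signof \<pi> * (\<Prod>i = 0..<k. mat k k f $$ (i, \<pi> i))\<bar>"
    by (subst det_def'[of _ k]) simp_all
  also have "\<dots> \<le> (\<Sum>\<pi>\<in>?P. \<bar>signof \<pi> * (\<Prod>i = 0..<k. mat k k f $$ (i, \<pi> i))\<bar>)"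
    by (rule sum_abs)
  also have "\<dots> \<le> (\<Sum>\<pi>\<in>?P. int B ^ k)"
  proof (rule sum_mono)
    fix \<pi> assume "\<pi> \<in> ?P"
    then have pi: "\<pi> permutes {0..<k}" by simp
    have "\<bar>signof \<pi> * (\<Prod>i = 0..<k. mat k k f $$ (i, \<pi> i))\<bar> = (\<Prod>i = 0..<k. \<bar>mat k k f $$ (i, \<pi> i)\<bar>)"
      by (simp add: abs_mult abs_prod sign_def)
    also have "\<dots> \<le> (\<Prod>i = 0..<k. int B)"
    proof (rule prod_mono)
      fix i assume i: "i \<in> {0..<k}"
      then have "\<pi> i < k" using permutes_in_image[OF pi, of i] by simp
      then show "0 \<le> \<bar>mat k k f $$ (i, \<pi> i)\<bar> \<and> \<bar>mat k k f $$ (i, \<pi> i)\<bar> \<le> int B"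
        using assms i by simp
    qed
    finally show "\<bar>signof \<pi> * (\<Prod>i = 0..<k. mat k k f $$ (i, \<pi> i))\<bar> \<le> int B ^ k" by simp
  qed
  also have "\<dots> = fact k * int B ^ k"
    by (simp add: card_permutations[of _ k])
  finally show ?thesis .
qed

text \<open>Every prime in question divides the leading minor of order \<open>k + 1\<close>, which
  does not involve the entry \<open>(k, k + 1)\<close>. So the candidate primes are fixed before
  that entry varies; there are fewer than \<open>k + 2\<close> of them, and each allows at most one
  value of the entry.\<close>

lemma card_large_prime_le:
  fixes n m k P B :: nat
  defines "\<Omega> \<equiv> PiE ({..<n} \<times> {..<m}) (\<lambda>_. {- int B..<int B})"
  assumes k: "k < n" "Suc k < m" and B: "B > 0" "fact (Suc k) \<le> B"
  shows "real (card {f \<in> \<Omega>. (\<forall>p. prime p \<and> P < p \<longrightarrow> \<not> row_dependent p k (Suc k) f) \<and>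
      det (mat (Suc k) (Suc k) f) \<noteq> 0 \<and>
      (\<exists>p. prime p \<and> P < p \<and> 2 * B < p \<and> row_dependent p (Suc k) (Suc (Suc k)) f)})
    \<le> real (k + 2) / real B * real (card \<Omega>)"
proof -
  let ?S = "{- int B..<int B}"
  let ?D = "\<lambda>f. det (mat (Suc k) (Suc k) f)"
  let ?Q = "\<lambda>f. (\<forall>p. prime p \<and> P < p \<longrightarrow> \<not> row_dependent p k (Suc k) f) \<and> ?D f \<noteq> 0"
  let ?R = "\<lambda>f. \<exists>p. prime p \<and> P < p \<and> 2 * B < p \<and> row_dependent p (Suc k) (Suc (Suc k)) f"
  let ?X = "{f \<in> \<Omega>. ?Q f \<and> ?R f}"
  have dep_upd: "row_dependent p k' (Suc k) (f((k, Suc k) := x)) = row_dependent p k' (Suc k) f" for p k' f x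
    by (rule row_dependent_cong) auto
  have D_upd: "?D (f((k, Suc k) := x)) = ?D f" for f x
    by (rule arg_cong[of _ _ det], rule cong_mat) auto
  have fin: "finite \<Omega>" unfolding \<Omega>_def by (simp add: finite_PiE)
  \<comment> \<open>A fibre has at most \<open>k + 2\<close> elements; the bound is doubled so that
    the 2 cancels against the side length \<open>2 * B\<close>.\<close>
  have "real (card ?X) * (2 * real B) \<le> real (2 * (k + 2)) * real (card {f \<in> \<Omega>. ?Q f})"
    unfolding \<Omega>_def
  proof (rule card_last_entry_fibers_le[OF k])
    show "{f \<in> PiE ({..<n} \<times> {..<m}) (\<lambda>_. ?S). ?Q f \<and> ?R f}
      \<subseteq> {f \<in> PiE ({..<n} \<times> {..<m}) (\<lambda>_. ?S). ?Q f}"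
      by blast
    fix f :: "nat \<times> nat \<Rightarrow> int" and x
    show "?Q (f((k, Suc k) := x)) = ?Q f"
      by (simp only: dep_upd D_upd)
  next
    fix f assume Q: "?Q f" and f: "f \<in> PiE ({..<n} \<times> {..<m}) (\<lambda>_. ?S)"
    define d where "d = nat \<bar>?D f\<bar>"
    define A where "A = {p. prime p \<and> P < p \<and> 2 * B < p \<and> p dvd d}"
    have d0: "d > 0" using Q by (simp add: d_def)
    have finA: "finite A"
      by (rule finite_subset[OF _ finite_atMost[of d]]) (use d0 in \<open>auto simp: A_def intro: dvd_imp_le\<close>)
    have "\<bar>?D f\<bar> \<le> fact (Suc k) * int B ^ Suc k"
    proof (rule abs_det_le)
      fix i j assume "i < Suc k" "j < Suc k"
      then have "f (i, j) \<in> ?S" using k by (intro PiE_mem[OF f]) auto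
      then show "\<bar>f (i, j)\<bar> \<le> int B" by auto
    qed
    then have "int d \<le> int (fact (Suc k) * B ^ Suc k)"
      by (simp add: d_def del: fact_Suc power_Suc)
    then have "d \<le> fact (Suc k) * B ^ Suc k" by (simp only: of_nat_le_iff)
    \<comment> \<open>The factorial from the Leibniz formula is absorbed by one more factor
      \<open>B\<close>; this is the purpose of \<open>fact (Suc k) <= B\<close>.\<close>
    also have "\<dots> \<le> B * B ^ Suc k"
      using B(2) by (rule mult_right_mono) simp
    also have "\<dots> < (2 * B) ^ (k + 2)"
      using power_strict_mono[of B "2 * B" "k + 2"] B(1) by simp
    finally have dlt: "d < (2 * B) ^ (k + 2)" .
    have cA: "card A < k + 2"
    proof (rule card_prime_divisors_less[OF finA _ d0 dlt])
      show "1 < 2 * B" using B(1) by simp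
      show "\<And>p. p \<in> A \<Longrightarrow> prime p \<and> p dvd d \<and> 2 * B \<le> p" by (simp add: A_def)
    qed
    let ?T = "\<lambda>p. {x \<in> ?S. row_dependent p (Suc k) (Suc (Suc k)) (f((k, Suc k) := x))}"
    have T: "card (?T p) \<le> 1" if "p \<in> A" for p
    proof -
      have p: "prime p" "P < p" "2 * B < p" "p dvd d" using that by (simp_all add: A_def)
      have "int p dvd ?D f" using p(4) by (simp add: d_def int_dvd_int_iff[symmetric])
      then have "row_dependent p (Suc k) (Suc k) f" using prime_dvd_det_iff[OF p(1)] by blast
      then have "real (card (?T p)) < 2 * real B / real p + 1"
        using Q p by (intro card_last_entry) auto
      also have "2 * real B / real p < 1" using p(3) by simp
      finally show ?thesis by simp
    qed
    have "{x \<in> ?S. f((k, Suc k) := x) \<in> {f \<in> PiE ({..<n} \<times> {..<m}) (\<lambda>_. ?S). ?Q f \<and> ?R f}} \<subseteq> (\<Union>p\<in>A. ?T p)"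
    proof
      fix x assume x: "x \<in> {x \<in> ?S. f((k, Suc k) := x) \<in> {f \<in> PiE ({..<n} \<times> {..<m}) (\<lambda>_. ?S). ?Q f \<and> ?R f}}"
      then obtain p where p: "prime p" "P < p" "2 * B < p"
          and dep: "row_dependent p (Suc k) (Suc (Suc k)) (f((k, Suc k) := x))" by blast
      from dep have "row_dependent p (Suc k) (Suc k) (f((k, Suc k) := x))"
        by (rule row_dependent_mono_cols) simp
      then have "int p dvd ?D f"
        using prime_dvd_det_iff[OF p(1)] by (simp only: dep_upd)
      then have "p \<in> A" using p by (simp add: A_def d_def int_dvd_int_iff[symmetric])
      then show "x \<in> (\<Union>p\<in>A. ?T p)" using x dep by blast
    qed
    then have "card {x \<in> ?S. f((k, Suc k) := x) \<in> {f \<in> PiE ({..<n} \<times> {..<m}) (\<lambda>_. ?S). ?Q f \<and> ?R f}} \<le> card (\<Union>p\<in>A. ?T p)"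
      by (rule card_mono[rotated]) (intro finite_UN_I finA finite_range_Collect)
    also have "\<dots> \<le> (\<Sum>p\<in>A. card (?T p))" by (rule card_UN_le[OF finA])
    also have "\<dots> \<le> (\<Sum>p\<in>A. 1)" by (rule sum_mono) (rule T)
    also have "\<dots> \<le> 2 * (k + 2)" using cA by simp
    finally show "real (card {x \<in> ?S. f((k, Suc k) := x) \<in> {f \<in> PiE ({..<n} \<times> {..<m}) (\<lambda>_. ?S). ?Q f \<and> ?R f}})
      \<le> real (2 * (k + 2))" by (simp only: of_nat_le_iff)
  qed
  also have "\<dots> \<le> real (2 * (k + 2)) * real (card \<Omega>)"
    using fin by (intro mult_left_mono of_nat_mono card_mono) auto
  finally have "real (card ?X) \<le> real (k + 2) / real B * real (card \<Omega>)"
    using B(1) by (simp add: field_simps)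
  then show ?thesis by (simp only: conj_assoc)
qed

text \<open>Telescoping, since \<open>1 / p^2 <= 1 / (p - 1) - 1 / p\<close>. The term
  \<open>1 / M\<close> is kept for the induction.\<close>

lemma sum_inverse_squares_le:
  assumes "1 \<le> P" "P \<le> M"
  shows "(\<Sum>p\<in>{P<..M}. 1 / (real p)\<^sup>2) \<le> 1 / real P - 1 / real M"
  using assms(2)
proof (induction M rule: dec_induct)
  case base
  then show ?case by simp
next
  case (step M)
  have M: "real M \<ge> 1" using step assms by simp
  have "{P<..Suc M} = insert (Suc M) {P<..M}" using step by auto
  then have "(\<Sum>p\<in>{P<..Suc M}. 1 / (real p)\<^sup>2) \<le> 1 / (real (Suc M))\<^sup>2 + (1 / real P - 1 / real M)"
    using step by simp
  also have "1 / (real (Suc M))\<^sup>2 \<le> 1 / (real M * real (Suc M))"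
    using M by (intro divide_left_mono) (auto simp: power2_eq_square)
  also have "\<dots> = 1 / real M - 1 / real (Suc M)"
    using M by (simp add: field_simps)
  finally show ?case by simp
qed

text \<open>In the induction step a bad matrix falls into one of four sets: \<open>?E\<close>, where
  the smaller block is already bad; \<open>?Z\<close>, which covers the vanishing minors;
  \<open>?M p\<close> for some \<open>p <= 2 * B\<close>; and \<open>?L\<close> for larger primes.
  Each step adds \<open>O(1 / B)\<close> and \<open>4 / P\<close>.\<close>

lemma card_row_dependent_large_primes_le:
  fixes n m k P B :: nat
  defines "\<Omega> \<equiv> PiE ({..<n} \<times> {..<m}) (\<lambda>_. {- int B..<int B})"
  assumes "n < m" "1 \<le> P" "1 \<le> B" "k \<le> n" "fact k \<le> B"
  shows "real (card {f \<in> \<Omega>. \<exists>p. prime p \<and> P < p \<and> row_dependent p k (Suc k) f})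
    \<le> (real (k * (k + 2)) / real B + 4 * real k / real P) * real (card \<Omega>)"
  using \<open>k \<le> n\<close> \<open>fact k \<le> B\<close>
proof (induction k)
  case 0
  show ?case by simp
next
  case (Suc k)
  have fin: "finite \<Omega>" unfolding \<Omega>_def by (simp add: finite_PiE)
  have k: "k < n" "Suc k < m" using Suc.prems assms(2) by auto
  let ?N = "real (card \<Omega>)"
  \<comment> \<open>A vanishing minor is divisible by every prime, in particular by
    \<open>p0\<close>. As \<open>p0 > P\<close>, the smaller block is independent modulo
    \<open>p0\<close> outside \<open>?E\<close>; as \<open>p0 > 2 * B\<close>, the resulting
    frequency is at most \<open>1 / B\<close>.\<close>
  obtain p0 where p0: "prime p0" "max P (2 * B) < p0" using bigger_prime by blast
  let ?E = "{f \<in> \<Omega>. \<exists>p. prime p \<and> P < p \<and> row_dependent p k (Suc k) f}"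
  let ?Z = "{f \<in> \<Omega>. \<not> row_dependent p0 k (Suc k) f \<and> row_dependent p0 (Suc k) (Suc k) f}"
  let ?M = "\<lambda>p. {f \<in> \<Omega>. \<not> row_dependent p k (Suc k) f \<and> row_dependent p (Suc k) (Suc (Suc k)) f}"
  let ?L = "{f \<in> \<Omega>. (\<forall>p. prime p \<and> P < p \<longrightarrow> \<not> row_dependent p k (Suc k) f) \<and>
      det (mat (Suc k) (Suc k) f) \<noteq> 0 \<and>
      (\<exists>p. prime p \<and> P < p \<and> 2 * B < p \<and> row_dependent p (Suc k) (Suc (Suc k)) f)}"
  let ?A = "{p \<in> {P<..2 * B}. prime p}"
  have finA: "finite ?A" by simp
  have "{f \<in> \<Omega>. \<exists>p. prime p \<and> P < p \<and> row_dependent p (Suc k) (Suc (Suc k)) f}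
      \<subseteq> ?E \<union> ?Z \<union> (\<Union>p\<in>?A. ?M p) \<union> ?L"
  proof
    fix f assume "f \<in> {f \<in> \<Omega>. \<exists>p. prime p \<and> P < p \<and> row_dependent p (Suc k) (Suc (Suc k)) f}"
    then obtain p where f: "f \<in> \<Omega>" and p: "prime p" "P < p" "row_dependent p (Suc k) (Suc (Suc k)) f"
      by blast
    show "f \<in> ?E \<union> ?Z \<union> (\<Union>p\<in>?A. ?M p) \<union> ?L"
    proof (cases "\<exists>p. prime p \<and> P < p \<and> row_dependent p k (Suc k) f")
      case True
      with f show ?thesis by blast
    next
      case nd: False
      show ?thesis
      proof (cases "det (mat (Suc k) (Suc k) f) = 0")
        case True
        then have "row_dependent p0 (Suc k) (Suc k) f"
          using prime_dvd_det_iff[OF p0(1), of "Suc k" f] by simp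
        moreover have "\<not> row_dependent p0 k (Suc k) f" using nd p0 by auto
        ultimately show ?thesis using f by simp
      next
        case D: False
        show ?thesis
        proof (cases "p \<le> 2 * B")
          case True
          with p f nd have "p \<in> ?A" "f \<in> ?M p" by auto
          then show ?thesis by blast
        next
          case False
          then have "2 * B < p" by simp
          with p f nd D have "f \<in> ?L" by blast
          then show ?thesis by blast
        qed
      qed
    qed
  qed
  then have "card {f \<in> \<Omega>. \<exists>p. prime p \<and> P < p \<and> row_dependent p (Suc k) (Suc (Suc k)) f}
      \<le> card (?E \<union> ?Z \<union> (\<Union>p\<in>?A. ?M p) \<union> ?L)"
    by (rule card_mono[rotated]) (use fin in simp)
  also have "\<dots> \<le> card ?E + card ?Z + (\<Sum>p\<in>?A. card (?M p)) + card ?L"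
    by (intro order_trans[OF card_Un_le] add_mono order_refl card_UN_le finA)
  finally have le: "real (card {f \<in> \<Omega>. \<exists>p. prime p \<and> P < p \<and> row_dependent p (Suc k) (Suc (Suc k)) f})
      \<le> real (card ?E) + real (card ?Z) + (\<Sum>p\<in>?A. real (card (?M p))) + real (card ?L)"
    by (simp only: of_nat_add[symmetric] of_nat_sum[symmetric] of_nat_le_iff)
  have "fact k \<le> (fact (Suc k) :: nat)" by (rule fact_mono) simp
  then have E: "real (card ?E) \<le> (real (k * (k + 2)) / real B + 4 * real k / real P) * ?N"
    using Suc.prems by (intro Suc.IH) linarith+
  have Z: "real (card ?Z) \<le> 1 / real B * ?N"
  proof -
    have "real (card ?Z) * (2 * real B) \<le> (2 * real B / real p0 + 1) * ?N"
      unfolding \<Omega>_def by (rule card_square_dependent_le[OF p0(1) k(1)]) (use k in simp)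
    also have "\<dots> \<le> 2 * ?N"
      using p0(2) by (intro mult_right_mono) auto
    finally show ?thesis using assms(4) by (simp add: field_simps)
  qed
  have L: "real (card ?L) \<le> real (k + 2) / real B * ?N"
    unfolding \<Omega>_def by (rule card_large_prime_le[OF k]) (use assms(4) Suc.prems in simp_all)
  have "(\<Sum>p\<in>?A. real (card (?M p))) \<le> (\<Sum>p\<in>?A. 4 * (1 / (real p)\<^sup>2) * ?N)"
  proof (rule sum_mono)
    fix p assume p: "p \<in> ?A"
    have p1: "real p > 0" using p by auto
    have "real (card (?M p)) \<le> (1 / real p + 1 / (2 * real B))\<^sup>2 * ?N"
      unfolding \<Omega>_def by (rule card_dependent_le) (use p k assms(4) in simp_all)
    also have "\<dots> \<le> (2 / real p)\<^sup>2 * ?N"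
    proof (intro mult_right_mono power_mono)
      \<comment> \<open>Here \<open>p <= 2 * B\<close> is used: the rounding error in the residue
        count is no larger than the main term.\<close>
      have "1 / (2 * real B) \<le> 1 / real p"
        using p p1 by (intro divide_left_mono) auto
      then show "1 / real p + 1 / (2 * real B) \<le> 2 / real p" by simp
    qed auto
    finally show "real (card (?M p)) \<le> 4 * (1 / (real p)\<^sup>2) * ?N"
      by (simp add: power_divide)
  qed
  also have "\<dots> = 4 * ?N * (\<Sum>p\<in>?A. 1 / (real p)\<^sup>2)"
    by (simp add: sum_distrib_left mult_ac)
  also have "\<dots> \<le> 4 * ?N * (1 / real P)"
  proof (rule mult_left_mono)
    have "(\<Sum>p\<in>?A. 1 / (real p)\<^sup>2) \<le> (\<Sum>p\<in>{P<..2 * B}. 1 / (real p)\<^sup>2)"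
      by (rule sum_mono2) auto
    also have "\<dots> \<le> 1 / real P"
    proof (cases "P \<le> 2 * B")
      case True
      have "(\<Sum>p\<in>{P<..2 * B}. 1 / (real p)\<^sup>2) \<le> 1 / real P - 1 / real (2 * B)"
        by (rule sum_inverse_squares_le[OF assms(3) True])
      also have "\<dots> \<le> 1 / real P" by simp
      finally show ?thesis .
    qed simp
    finally show "(\<Sum>p\<in>?A. 1 / (real p)\<^sup>2) \<le> 1 / real P" .
  qed simp
  finally have M: "(\<Sum>p\<in>?A. real (card (?M p))) \<le> 4 / real P * ?N" by simp
  have "real (card {f \<in> \<Omega>. \<exists>p. prime p \<and> P < p \<and> row_dependent p (Suc k) (Suc (Suc k)) f})
    \<le> (real (k * (k + 2)) / real B + 4 * real k / real P) * ?N + 1 / real B * ?N + 4 / real P * ?N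
      + real (k + 2) / real B * ?N"
    using le E Z M L by linarith
  \<comment> \<open>The numerator over \<open>B\<close> is \<open>k^2 + 3k + 3\<close>, at most
    \<open>(k + 1)(k + 3) = k^2 + 4k + 3\<close>.\<close>
  also have "\<dots> = ((real (k * (k + 2)) + 1 + real (k + 2)) / real B + (4 * real k + 4) / real P) * ?N"
    by (simp only: add_divide_distrib distrib_right)
  also have "\<dots> \<le> (real (Suc k * (Suc k + 2)) / real B + 4 * real (Suc k) / real P) * ?N"
    by (intro mult_right_mono add_mono divide_right_mono) (auto simp: algebra_simps)
  finally show ?case .
qed

section \<open>The Euler product\<close>

text \<open>Terms of the Dirichlet series of zeta with the multiples of primes in \<open>A\<close>
  struck out. Indexing from 0 makes \<open>k\<close> to \<open>p * k\<close> a reindexing of the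
  whole series; for \<open>s > 0\<close> the term at 0 is 0, as \<open>1 / 0 = 0\<close>.\<close>

definition sieved_term :: "nat \<Rightarrow> nat set \<Rightarrow> nat \<Rightarrow> real" where
  "sieved_term s A k = (if \<forall>p\<in>A. \<not> p dvd k then 1 / real k ^ s else 0)"

lemma summable_sieved_term:
  assumes "2 \<le> s"
  shows "summable (sieved_term s A)"
proof (rule bounded_imp_summable)
  show "0 \<le> sieved_term s A k" for k by (simp add: sieved_term_def)
  show "(\<Sum>k\<le>N. sieved_term s A k) \<le> 2" for N
  proof -
    have "(\<Sum>k\<le>N. sieved_term s A k) \<le> (\<Sum>k\<le>N. 1 / (real k)\<^sup>2)"
    proof (rule sum_mono)
      fix k
      have "1 / real k ^ s \<le> 1 / (real k)\<^sup>2"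
      proof (cases "k = 0")
        case True
        then show ?thesis using assms by (simp add: zero_power)
      next
        case False
        then show ?thesis
          using assms by (intro divide_left_mono power_increasing) auto
      qed
      then show "sieved_term s A k \<le> 1 / (real k)\<^sup>2" by (simp add: sieved_term_def)
    qed
    also have "\<dots> \<le> (\<Sum>k\<in>{0, 1} \<union> {1<..Suc N}. 1 / (real k)\<^sup>2)"
      by (rule sum_mono2) auto
    also have "\<dots> = 1 + (\<Sum>k\<in>{1<..Suc N}. 1 / (real k)\<^sup>2)"
      by (subst sum.union_disjoint) auto
    also have "(\<Sum>k\<in>{1<..Suc N}. 1 / (real k)\<^sup>2) \<le> 1 / real 1 - 1 / real (Suc N)"
      by (rule sum_inverse_squares_le) simp_all
    also have "1 + (1 / real 1 - 1 / real (Suc N)) \<le> 2" by simp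
    finally show ?thesis by simp
  qed
qed

text \<open>The terms struck out are those at multiples \<open>p * k\<close>. Since \<open>p\<close>
  does not affect divisibility by the other primes, they form \<open>1 / p ^ s\<close> times the old
  series.\<close>

lemma suminf_sieved_term_insert:
  assumes s: "2 \<le> s" and p: "prime p" "p \<notin> A" and A: "\<And>q. q \<in> A \<Longrightarrow> prime q"
  shows "suminf (sieved_term s (insert p A)) = (1 - 1 / real p ^ s) * suminf (sieved_term s A)"
proof -
  let ?m = "\<lambda>k. if p dvd k then sieved_term s A k else 0"
  have p0: "p > 0" using p(1) prime_gt_0_nat by blast
  have mult: "sieved_term s A (p * k) = 1 / real p ^ s * sieved_term s A k" for k
  proof -
    have "q dvd p * k \<longleftrightarrow> q dvd k" if "q \<in> A" for q
    proof -
      have "q \<noteq> p" "prime q" using that p(2) A by auto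
      then have "\<not> q dvd p" using p(1) primes_dvd_imp_eq by blast
      then show ?thesis using \<open>prime q\<close> by (simp add: prime_dvd_mult_iff)
    qed
    then show ?thesis
      by (simp add: sieved_term_def power_mult_distrib)
  qed
  have "strict_mono (\<lambda>k. p * k)" using p0 by (simp add: strict_mono_def)
  then have re: "suminf (\<lambda>k. ?m (p * k)) = suminf ?m"
    by (rule suminf_mono_reindex) auto
  have sm: "summable ?m"
    by (rule summable_comparison_test'[OF summable_sieved_term[OF s, of A], of 0])
      (simp add: sieved_term_def)
  have "suminf ?m = 1 / real p ^ s * suminf (sieved_term s A)"
    unfolding re[symmetric] using suminf_mult[OF summable_sieved_term[OF s], of "1 / real p ^ s" A]
    by (simp add: mult)
  moreover have "sieved_term s (insert p A) = (\<lambda>k. sieved_term s A k - ?m k)"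
    by (auto simp: sieved_term_def)
  then have "suminf (sieved_term s (insert p A)) = suminf (sieved_term s A) - suminf ?m"
    using suminf_diff[OF summable_sieved_term[OF s] sm, of A] by simp
  ultimately show ?thesis by (simp add: algebra_simps)
qed

lemma suminf_sieved_term:
  assumes "2 \<le> s" "finite A" "\<And>q. q \<in> A \<Longrightarrow> prime q"
  shows "suminf (sieved_term s A) = (\<Prod>p\<in>A. 1 - 1 / real p ^ s) * suminf (sieved_term s {})"
  using assms(2,3)
proof (induction A rule: finite_induct)
  case (insert p A)
  then show ?case
    using suminf_sieved_term_insert[OF assms(1), of p A] by simp
qed simp

lemma riemann_zeta_eq_suminf:
  assumes "2 \<le> s"
  shows "riemann_zeta (real s) = suminf (sieved_term s {})"
proof -
  have "riemann_zeta (real s) = (\<Sum>k. sieved_term s {} (Suc k))"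
    unfolding riemann_zeta_def by (simp add: sieved_term_def powr_realpow del: of_nat_Suc)
  also have "\<dots> = suminf (sieved_term s {}) - sieved_term s {} 0"
    using summable_sieved_term[OF assms] by (rule suminf_split_head)
  finally show ?thesis using assms by (simp add: sieved_term_def)
qed

text \<open>The partial product times zeta is the series sieved by all primes up to
  \<open>P\<close>. Every index from 2 to \<open>P\<close> has such a prime factor, so what remains
  is 1 plus part of the tail of a convergent series.\<close>

lemma euler_product:
  assumes s: "2 \<le> s"
  shows "(\<lambda>P. \<Prod>p | prime p \<and> p \<le> P. 1 - 1 / real p ^ s) \<longlonglongrightarrow> 1 / riemann_zeta (real s)"
proof -
  let ?A = "\<lambda>P. {p. prime p \<and> p \<le> P} :: nat set"
  let ?a = "sieved_term s {}"
  have sum_a: "summable ?a" by (rule summable_sieved_term[OF s])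
  have a0: "0 \<le> sieved_term s A k" for A k by (simp add: sieved_term_def)
  have bounds: "1 \<le> suminf (sieved_term s (?A P)) \<and> suminf (sieved_term s (?A P)) \<le> 1 + (suminf ?a - sum ?a {..<Suc P})"
    if "P \<ge> 1" for P
  proof -
    have g: "sieved_term s (?A P) k = (if k = 1 then 1 else 0)" if "k < Suc P" for k
    proof (cases "k \<le> 1")
      case True
      then consider "k = 0" | "k = 1" by linarith
      then show ?thesis using s by cases (auto simp: sieved_term_def)
    next
      case False
      then obtain p where p: "prime p" "p dvd k" using prime_factor_nat[of k] by auto
      then have "p \<le> k" using False by (intro dvd_imp_le) auto
      then have "p \<in> ?A P" using p that by simp
      then show ?thesis using p False by (auto simp: sieved_term_def)
    qed
    have "sum (sieved_term s (?A P)) {..<Suc P} = (\<Sum>k<Suc P. if k = 1 then 1 else 0)"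
      by (rule sum.cong) (use g in auto)
    also have "\<dots> = 1" using \<open>P \<ge> 1\<close> by (simp add: sum.delta del: sum.lessThan_Suc)
    finally have init: "sum (sieved_term s (?A P)) {..<Suc P} = 1" .
    have split: "suminf (sieved_term s A) = (\<Sum>k. sieved_term s A (k + Suc P)) + sum (sieved_term s A) {..<Suc P}" for A
      by (rule suminf_split_initial_segment[OF summable_sieved_term[OF s]])
    have tail: "summable (\<lambda>k. sieved_term s A (k + Suc P))" for A
      using summable_sieved_term[OF s] by (rule summable_ignore_initial_segment)
    have "(\<Sum>k. sieved_term s (?A P) (k + Suc P)) \<le> (\<Sum>k. ?a (k + Suc P))"
      by (rule suminf_le[OF _ tail tail]) (simp add: sieved_term_def)
    moreover have "0 \<le> (\<Sum>k. sieved_term s (?A P) (k + Suc P))"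
      by (rule suminf_nonneg[OF tail]) (rule a0)
    ultimately show ?thesis
      using split[of "?A P"] split[of "{}"] init by linarith
  qed
  have "(\<lambda>P. sum ?a {..<Suc P}) \<longlonglongrightarrow> suminf ?a"
    using summable_LIMSEQ[OF sum_a] by (rule LIMSEQ_Suc)
  then have "(\<lambda>P. 1 + (suminf ?a - sum ?a {..<Suc P})) \<longlonglongrightarrow> 1 + (suminf ?a - suminf ?a)"
    by (intro tendsto_intros)
  then have "(\<lambda>P. 1 + (suminf ?a - sum ?a {..<Suc P})) \<longlonglongrightarrow> 1" by simp
  then have lim: "(\<lambda>P. suminf (sieved_term s (?A P))) \<longlonglongrightarrow> 1"
    by (rule tendsto_sandwich[OF _ _ tendsto_const, rotated 2])
      (use bounds in \<open>auto intro!: eventually_sequentiallyI[of 1]\<close>)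
  \<comment> \<open>Only the term at 1 contributes; this shows that zeta is positive and may be
    divided by.\<close>
  have "sum ?a {..<2} \<le> suminf ?a"
    by (rule sum_le_suminf[OF sum_a]) (use a0 in auto)
  moreover have "sum ?a {..<2} = 1"
    using s by (simp add: sieved_term_def numeral_2_eq_2 zero_power)
  ultimately have z: "suminf ?a > 0" by linarith
  have "(\<Prod>p | prime p \<and> p \<le> P. 1 - 1 / real p ^ s) = suminf (sieved_term s (?A P)) / suminf ?a" for P
  proof -
    have "finite (?A P)" by (rule finite_subset[of _ "{..P}"]) auto
    then have "suminf (sieved_term s (?A P)) = (\<Prod>p\<in>?A P. 1 - 1 / real p ^ s) * suminf ?a"
      by (rule suminf_sieved_term[OF s]) simp
    then show ?thesis using z by simp
  qed
  then show ?thesis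
    using tendsto_divide[OF lim tendsto_const, of "suminf ?a"] z
    by (simp add: riemann_zeta_eq_suminf[OF s])
qed

section \<open>The density\<close>

text \<open>First \<open>P\<close> is chosen, then \<open>B\<close> is taken large. Four errors
  below \<open>e / 4\<close> add up: truncation of the Euler product, the finite-box error of the
  periodic condition, and the two parts \<open>4 * n / P\<close> and \<open>n * (n + 2) / B\<close>
  of the bound for large primes.\<close>

lemma density_independent_all_primes:
  fixes n m :: nat
  assumes "n < m"
  shows "(\<lambda>B. real (card {f \<in> PiE ({..<n} \<times> {..<m}) (\<lambda>_. {- int B..<int B}).
      \<forall>p. prime p \<longrightarrow> \<not> row_dependent p n m f}) / (2 * real B) ^ (n * m))
    \<longlonglongrightarrow> (\<Prod>i<n. 1 / riemann_zeta (real (m - i)))" (is "?F \<longlonglongrightarrow> ?L")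
proof (rule LIMSEQ_I)
  fix e :: real assume e: "0 < e"
  let ?\<Omega> = "\<lambda>B. PiE ({..<n} \<times> {..<m}) (\<lambda>_. {- int B..<int B})"
  let ?A = "\<lambda>P. {p. prime p \<and> p \<le> P} :: nat set"
  let ?c = "\<lambda>P. \<Prod>p\<in>?A P. \<Prod>i<n. 1 - 1 / real p ^ (m - i)"
  let ?G = "\<lambda>P B. real (card {f \<in> ?\<Omega> B. \<forall>p\<in>?A P. \<not> row_dependent p n m f}) / (2 * real B) ^ (n * m)"
  have "(\<lambda>P. \<Prod>i<n. \<Prod>p\<in>?A P. 1 - 1 / real p ^ (m - i)) \<longlonglongrightarrow> ?L"
    \<comment> \<open>Since \<open>i < n < m\<close>, each exponent \<open>m - i\<close> is at least
      2, as Euler's product requires.\<close>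
    by (intro tendsto_prod euler_product) (use assms in auto)
  also have "(\<lambda>P. \<Prod>i<n. \<Prod>p\<in>?A P. 1 - 1 / real p ^ (m - i)) = ?c"
    by (rule ext, rule prod.swap)
  finally have "eventually (\<lambda>P. \<bar>?c P - ?L\<bar> < e / 4) sequentially"
    using e by (intro tendstoD[of ?c ?L, unfolded dist_real_def]) auto
  moreover have "(\<lambda>P. 4 * real n * (1 / real P)) \<longlonglongrightarrow> 4 * real n * 0"
    by (intro tendsto_mult_left lim_1_over_n)
  then have "eventually (\<lambda>P. 4 * real n * (1 / real P) < e / 4) sequentially"
    using e by (intro order_tendstoD(2)) auto
  moreover have "eventually (\<lambda>P::nat. 1 \<le> P) sequentially" by (rule eventually_ge_at_top)
  ultimately have "eventually (\<lambda>P. \<bar>?c P - ?L\<bar> < e / 4 \<and> 4 * real n * (1 / real P) < e / 4 \<and> 1 \<le> P) sequentially"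
    by (intro eventually_conj)
  then obtain P where P: "\<bar>?c P - ?L\<bar> < e / 4" "4 * real n * (1 / real P) < e / 4" "1 \<le> P"
    using eventually_happens by force
  let ?q = "\<Prod>(?A P)"
  have q0: "?q > 0" by (intro prod_pos) (auto simp: prime_gt_0_nat)
  have per: "periodic ({..<n} \<times> {..<m}) ?q (\<lambda>f. \<forall>p\<in>?A P. \<not> row_dependent p n m f)"
    unfolding periodic_def
  proof (intro allI impI ball_cong refl)
    fix f g p assume "\<forall>i\<in>{..<n} \<times> {..<m}. [f i = g i] (mod int ?q)" and p: "p \<in> ?A P"
    moreover have "p dvd ?q" by (rule dvd_prodI[OF _ p]) simp
    ultimately show "(\<not> row_dependent p n m f) = (\<not> row_dependent p n m g)"
      using periodic_row_dependent[of p ?q n m] unfolding periodic_def by simp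
  qed
  have finA: "finite (?A P)" by (rule finite_subset[of _ "{..P}"]) auto
  have cardI: "card ({..<n} \<times> {..<m}) = n * m" by (simp add: card_cartesian_product)
  have "real (card (residues_sat ({..<n} \<times> {..<m}) ?q (\<lambda>f. \<forall>p\<in>?A P. \<not> row_dependent p n m f)))
      / real ?q ^ (n * m) = ?c P"
    by (rule independent_residues_density[OF _ finA]) (use assms in simp_all)
  with periodic_density[OF _ q0 per] have "(\<lambda>B. ?G P B) \<longlonglongrightarrow> ?c P"
    unfolding cardI by (simp only: finite_cartesian_product finite_lessThan)
  then have "eventually (\<lambda>B. \<bar>?G P B - ?c P\<bar> < e / 4) sequentially"
    using e by (intro tendstoD[of "?G P" "?c P", unfolded dist_real_def]) auto
  moreover have "(\<lambda>B. real (n * (n + 2)) * (1 / real B)) \<longlonglongrightarrow> real (n * (n + 2)) * 0"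
    by (intro tendsto_mult_left lim_1_over_n)
  then have "eventually (\<lambda>B. real (n * (n + 2)) * (1 / real B) < e / 4) sequentially"
    using e by (intro order_tendstoD(2)) auto
  moreover have "eventually (\<lambda>B::nat. fact n \<le> B \<and> 1 \<le> B) sequentially"
    by (intro eventually_conj eventually_ge_at_top)
  ultimately have "eventually (\<lambda>B. \<bar>?F B - ?L\<bar> < e) sequentially"
  proof eventually_elim
    case (elim B)
    let ?all = "{f \<in> ?\<Omega> B. \<forall>p. prime p \<longrightarrow> \<not> row_dependent p n m f}"
    let ?few = "{f \<in> ?\<Omega> B. \<forall>p\<in>?A P. \<not> row_dependent p n m f}"
    let ?bad = "{f \<in> ?\<Omega> B. \<exists>p. prime p \<and> P < p \<and> row_dependent p n (Suc n) f}"
    have fin: "finite (?\<Omega> B)" by (simp add: finite_PiE)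
    define N where "N = (2 * real B) ^ (n * m)"
    have card\<Omega>: "real (card (?\<Omega> B)) = N"
      by (simp add: card_PiE card_cartesian_product N_def)
    have N0: "N > 0" using elim by (simp add: N_def)
    \<comment> \<open>A dependence not seen by the primes up to \<open>P\<close> comes from a larger
      prime and persists on the first \<open>n + 1 <= m\<close> columns, where the bound
      applies.\<close>
    have "?few \<subseteq> ?all \<union> ?bad"
    proof
      fix f assume f: "f \<in> ?few"
      show "f \<in> ?all \<union> ?bad"
      proof (cases "\<exists>p. prime p \<and> row_dependent p n m f")
        case True
        then obtain p where p: "prime p" "row_dependent p n m f" by blast
        have "P < p" using f p by (metis (mono_tags, lifting) linorder_not_le mem_Collect_eq)
        moreover have "row_dependent p n (Suc n) f"
          using p(2) by (rule row_dependent_mono_cols) (use assms in simp)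
        ultimately show ?thesis using f p(1) by blast
      next
        case False
        with f show ?thesis by blast
      qed
    qed
    then have "card ?few \<le> card (?all \<union> ?bad)"
      by (rule card_mono[rotated]) (use fin in simp)
    also have "\<dots> \<le> card ?all + card ?bad" by (rule card_Un_le)
    finally have "real (card ?few) \<le> real (card ?all) + real (card ?bad)"
      by (simp only: of_nat_add[symmetric] of_nat_le_iff)
    also have "real (card ?bad) \<le> (real (n * (n + 2)) / real B + 4 * real n / real P) * N"
      unfolding card\<Omega>[symmetric]
      by (rule card_row_dependent_large_primes_le[OF assms P(3)]) (use elim in simp_all)
    finally have "real (card ?few) \<le> real (card ?all) + (real (n * (n + 2)) / real B + 4 * real n / real P) * N"
      by simp
    then have "real (card ?few) / N \<le> real (card ?all) / N + (real (n * (n + 2)) / real B + 4 * real n / real P)"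
      using N0 by (simp add: pos_divide_le_eq distrib_right)
    moreover have "real (card ?all) / N \<le> real (card ?few) / N"
      using fin N0 by (intro divide_right_mono of_nat_mono card_mono) auto
    ultimately show "\<bar>?F B - ?L\<bar> < e"
      using elim P unfolding N_def by (simp only: times_divide_eq_right mult_1_right)
  qed
  then show "\<exists>N. \<forall>B\<ge>N. norm (?F B - ?L) < e"
    by (simp add: eventually_sequentially)
qed

text \<open>The index map \<open>(i, j)\<close> to \<open>i * m + j\<close>, inverted by
  \<open>div\<close> and \<open>mod\<close>, matches extensional functions on the index rectangle
  with vectors of length \<open>n * m\<close>.\<close>

lemma card_vec_of_mat_rect_unimodular:
  assumes "n < m"
  shows "card (vec_of_mat ` rect_unimodular n m \<inter> int_cube (n * m) B)
    = card {f \<in> PiE ({..<n} \<times> {..<m}) (\<lambda>_. {- int B..<int B}). \<forall>p. prime p \<longrightarrow> \<not> row_dependent p n m f}"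
proof -
  let ?I = "{..<n} \<times> {..<m}"
  let ?v = "\<lambda>f :: nat \<times> nat \<Rightarrow> int. vec (n * m) (\<lambda>k. f (k div m, k mod m))"
  let ?T = "{f \<in> PiE ?I (\<lambda>_. {- int B..<int B}). \<forall>p. prime p \<longrightarrow> \<not> row_dependent p n m f}"
  have idx: "i * m + j < n * m" "(i * m + j) div m = i" "(i * m + j) mod m = j" if "i < n" "j < m" for i j
  proof -
    have "i * m + j < Suc i * m" using that by simp
    also have "\<dots> \<le> n * m" using that by (intro mult_le_mono1) simp
    finally show "i * m + j < n * m" .
  qed (use that in simp_all)
  have pos: "0 < m" using assms by simp
  have rng: "k div m < n" "k mod m < m" if "k < n * m" for k
    using that pos by (simp_all add: less_mult_imp_div_less)
  have v_nth: "?v f $ (i * m + j) = f (i, j)" if "i < n" "j < m" for f i j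
    using idx[OF that] by simp
  have inj: "inj_on ?v ?T"
  proof (rule inj_onI)
    fix f g assume f: "f \<in> ?T" and g: "g \<in> ?T" and eq: "?v f = ?v g"
    have fg: "f \<in> PiE ?I (\<lambda>_. {- int B..<int B})" "g \<in> PiE ?I (\<lambda>_. {- int B..<int B})"
      using f g by simp_all
    show "f = g"
    proof (rule PiE_ext[OF fg])
      fix ij assume "ij \<in> ?I"
      then obtain i j where ij: "ij = (i, j)" "i < n" "j < m" by auto
      show "f ij = g ij"
        using v_nth[OF ij(2,3), of f] v_nth[OF ij(2,3), of g] unfolding ij(1) eq by simp
    qed
  qed
  have rect: "mat n m f \<in> rect_unimodular n m \<longleftrightarrow> (\<forall>p. prime p \<longrightarrow> \<not> row_dependent p n m f)" for f
  proof -
    have "row_dependent p n m (\<lambda>ij. mat n m f $$ ij) = row_dependent p n m f" for p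
      by (rule row_dependent_cong) simp
    then show ?thesis
      using rect_unimodular_iff[of n m "mat n m f"] assms by simp
  qed
  have vm: "vec_of_mat (mat n m f) = ?v f" for f
    unfolding vec_of_mat_def by (rule eq_vecI) (use rng in simp_all)
  have "vec_of_mat ` rect_unimodular n m \<inter> int_cube (n * m) B = ?v ` ?T"
  proof (intro equalityI subsetI)
    fix v assume v: "v \<in> vec_of_mat ` rect_unimodular n m \<inter> int_cube (n * m) B"
    then obtain M where M: "M \<in> rect_unimodular n m" "v = vec_of_mat M" by blast
    define f where "f = (\<lambda>ij\<in>?I. M $$ ij)"
    have carr: "M \<in> carrier_mat n m" using M(1) by (simp add: rect_unimodular_def)
    have Mf: "M = mat n m f" by (rule eq_matI) (use carr in \<open>auto simp: f_def\<close>)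
    have vf: "v = ?v f" using M(2) unfolding Mf vm .
    have "f \<in> PiE ?I (\<lambda>_. {- int B..<int B})"
    proof (rule PiE_I)
      fix ij assume "ij \<in> ?I"
      then obtain i j where ij: "ij = (i, j)" "i < n" "j < m" by auto
      have "- int B \<le> v $ (i * m + j) \<and> v $ (i * m + j) < int B"
        using v idx(1)[OF ij(2,3)] by (simp add: int_cube_def)
      then show "f ij \<in> {- int B..<int B}"
        unfolding vf v_nth[OF ij(2,3)] ij(1) by simp
    qed (simp add: f_def)
    moreover have "\<forall>p. prime p \<longrightarrow> \<not> row_dependent p n m f"
      using M(1) rect[of f] unfolding Mf by simp
    ultimately show "v \<in> ?v ` ?T" using vf by blast
  next
    fix v assume "v \<in> ?v ` ?T"
    then obtain f where f: "f \<in> ?T" "v = ?v f" by (rule imageE)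
    have "mat n m f \<in> rect_unimodular n m" using f(1) rect[of f] by simp
    then have "v \<in> vec_of_mat ` rect_unimodular n m"
      using f(2) vm[of f] by (metis imageI)
    moreover have "v \<in> int_cube (n * m) B"
    proof -
      have "f (k div m, k mod m) \<in> {- int B..<int B}" if "k < n * m" for k
        by (rule PiE_mem[of f ?I]) (use f(1) rng[OF that] in simp_all)
      then show ?thesis unfolding f(2) int_cube_def by simp
    qed
    ultimately show "v \<in> vec_of_mat ` rect_unimodular n m \<inter> int_cube (n * m) B" by blast
  qed
  then show ?thesis using card_image[OF inj] by simp
qed

theorem corollary17:
  fixes n m :: nat
  assumes "0 < n" and "n < m"
  shows "has_density (n * m) (vec_of_mat ` rect_unimodular n m)
           (\<Prod>i = 0..<n. 1 / riemann_zeta (real (m - i)))"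
  using density_independent_all_primes[OF assms(2)]
  unfolding has_density_def card_vec_of_mat_rect_unimodular[OF assms(2)] atLeast0LessThan .

end
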